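(* For every $n\ge0$ fix a sequence $f^{(n)}\in T_{\mathbb Z}$ with $f^{(n)}_0=\dots=f^{(n)}_{n-1}=0$ and $f^{(n)}_n=\tilde d_n$ (such sequences exist). Then every sequence $a\in T_{\mathbb Z}\simeq\mathrm{Op}^{st}_{\mathbb Z}(K_{gr})$ can be written in the form $$a=\sum_{i=0}^\infty\Big[b_{2i}\,\Pi^{-i}\theta(f^{(2i)})+b_{2i+1}\,\Pi^{i}(f^{(2i+1)})\Big]$$ for unique $b_0,b_1,\ldots\in\mathbb Z$.
   Context: For a sequence $a=(a_i)_{i\in\mathbb Z}\in R^{\mathbb Z}$ an $n$-interval of $a$ is an $n$-tuple $(a_i,a_{i+1},\dots,a_{i+n-1})$ for some $i$ (it starts at $i$). The shift is $\Pi(a)_i=a_{i+1}$ and the reflection is $\theta(a)_i=a_{-i}$. For $n\ge1$ let $M_n\subset\mathbb Z^n$ be the subgroup generated by the $n$-tuples $(1,r,r^2,\dots,r^{n-1})$ for all integers $r>0$. $T_{\mathbb Z}\subset\mathbb Z^{\mathbb Z}$ is the subgroup of all sequences $a$ such that for every $n\ge1$ every $n$-interval of $a$ lies in $M_n$. Let $\widehat{\mathbb Z}=\lim\mathbb Z/n\mathbb Z$ and let $N_n\subset\widehat{\mathbb Z}^n$ be the $\widehat{\mathbb Z}$-submodule generated by the tuples $(1,r,\dots,r^{n-1})$ for all $r\in\widehat{\mathbb Z}^\times$. For $n\ge0$, $\tilde d_n$ is the unique positive integer generating the ideal of all $t\in\widehat{\mathbb Z}$ such that the $(n+1)$-tuple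 $(0,\dots,0,t)$ lies in $N_{n+1}$; equivalently $v_p(\tilde d_n)=v_p\big((n+\lfloor\frac n{p-1}\rfloor)!\big)$ for all primes $p$. Infinite sums are taken in $\mathbb Z^{\mathbb Z}$ termwise (each coordinate involves only finitely many nonzero terms). The identification with stable operations: over a field $k$ of characteristic $0$, graded $K$-theory is $K_{gr}^*(X)=K_0(X)[t,t^{-1}]$, $\deg t=-1$, on smooth quasi-projective varieties, with formal group law $x+y-txy$. The additive operations $K^n_{gr}\to K^n_{gr}$ form a group identified with $\mathbb Z[[x]]$ (the Adams operation $\Psi_m$ corresponding to $(1-x)^m$), the desuspension operator is $\Phi(G)=(x-1)\frac{dG}{dx}$, and $\mathrm{Op}^{st}_{\mathbb Z}(K_{gr})=\lim(\mathbb Z[[x]]\xleftarrow{\Phi}\mathbb Z[[x]]\xleftarrow{\Phi}\cdots)$ is the group of degree $0$ stable operations. Let $b:\mathbb Z[[x]]\to\mathbb Z^{[0,\infty)}$ be the injective homomorphism, continuous for the $x$-adic topology and the product topology, taking $(1-x)^m$ to $(1,m,m^2,\dots)$. The isomorphism $T_{\mathbb Z}\simeq\mathrm{Op}^{st}_{\mathbb Z}(K_{gr})$ takes $a$ to the sequence $(G_n)_{n\ge0}$ with $b(G_n)=(a_{-n},a_{-n+1},\dots)$. *)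

theory Defs
  imports
    "HOL-Analysis.Function_Topology"
    "HOL-Computational_Algebra.Formal_Power_Series"
    "HOL-Computational_Algebra.Group_Closure"
    "HOL-Library.Function_Algebras"
begin

section \<open>Integer sequences indexed by the integers\<close>

definition shift :: "(int \<Rightarrow> 'a) \<Rightarrow> int \<Rightarrow> 'a" where
  "shift a = (\<lambda>i. a (i + 1))"

definition reflect :: "(int \<Rightarrow> 'a) \<Rightarrow> int \<Rightarrow> 'a" where
  "reflect a = (\<lambda>i. a (- i))"

lemma bij_shift: "bij shift"
  by (rule bij_betw_byWitness[where f' = "\<lambda>a i. a (i - 1)"]) (auto simp: shift_def)

lemma inv_shift: "inv shift = (\<lambda>a i. a (i - 1))"
  by (rule inv_equality) (auto simp: shift_def)

text \<open>An \<open>n\<close>-tuple over a ring is a function on the naturals that vanishes outside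
  \<open>{..<n}\<close>; addition of tuples is the pointwise addition of functions.\<close>

definition power_tuple :: "nat \<Rightarrow> 'a::comm_ring_1 \<Rightarrow> nat \<Rightarrow> 'a" where
  "power_tuple n r = (\<lambda>j. if j < n then r ^ j else 0)"

definition interval_at :: "nat \<Rightarrow> (int \<Rightarrow> int) \<Rightarrow> int \<Rightarrow> nat \<Rightarrow> int" where
  "interval_at n a i = (\<lambda>j. if j < n then a (i + int j) else 0)"

definition M_sub :: "nat \<Rightarrow> (nat \<Rightarrow> int) set" where
  "M_sub n = group_closure {power_tuple n r | r. r > 0}"

definition T_Z :: "(int \<Rightarrow> int) set" where
  "T_Z = {a. \<forall>n\<ge>1. \<forall>i. interval_at n a i \<in> M_sub n}"


section \<open>Profinite integers and the numbers \<open>dtilde n\<close>\<close>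

text \<open>An element of the inverse limit of the rings \<open>\<int>/n\<int>\<close>, \<open>n \<ge> 1\<close>, is stored as the family
  of its canonical representatives in \<open>{0..<n}\<close>. In \<open>compatible\<close>, the case \<open>m = n\<close> says that
  the representatives are canonical, and the entry at 0 is a dummy.\<close>

definition compatible :: "(nat \<Rightarrow> int) \<Rightarrow> bool" where
  "compatible a \<longleftrightarrow> a 0 = 0 \<and> (\<forall>n>0. \<forall>m. m dvd n \<longrightarrow> a m = a n mod int m)"

lemma compatible_0: "compatible a \<Longrightarrow> a 0 = 0"
  by (simp only: compatible_def)

lemma compatible_mod: "compatible a \<Longrightarrow> a n mod int n = a n"
  by (cases "n = 0") (metis compatible_def dvd_refl mod_0 not_gr_zero)+

lemma compatibleI:
  assumes "a 0 = 0"
    and "\<And>m n. n > 0 \<Longrightarrow> int m dvd int n \<Longrightarrow> a m = a n mod int m"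
  shows "compatible a"
  using assms unfolding compatible_def by (metis int_dvd_int_iff)

lemma compatibleD:
  assumes "compatible a" "n > 0" "int m dvd int n"
  shows "a m = a n mod int m"
  using assms unfolding compatible_def by (metis int_dvd_int_iff)

typedef zhat = "{a. compatible a}"
  by (rule exI[of _ "\<lambda>_. 0"]) (simp add: compatible_def)

setup_lifting type_definition_zhat

instantiation zhat :: comm_ring_1
begin

lift_definition zero_zhat :: zhat is "\<lambda>_. 0" by (simp add: compatible_def)

lift_definition one_zhat :: zhat is "\<lambda>n. if n = 0 then 0 else 1 mod int n"
  by (rule compatibleI) (auto simp: mod_mod_cancel)

lift_definition plus_zhat :: "zhat \<Rightarrow> zhat \<Rightarrow> zhat" is "\<lambda>a b n. (a n + b n) mod int n"
proof (rule compatibleI)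
  fix a b :: "nat \<Rightarrow> int" and m n :: nat
  assume "compatible a" "compatible b" "n > 0" and d: "int m dvd int n"
  then have "a m = a n mod int m" "b m = b n mod int m"
    by (blast intro: compatibleD)+
  then show "(a m + b m) mod int m = (a n + b n) mod int n mod int m"
    by (simp only: mod_mod_cancel[OF d] mod_add_eq)
qed (simp add: compatible_def)

lift_definition minus_zhat :: "zhat \<Rightarrow> zhat \<Rightarrow> zhat" is "\<lambda>a b n. (a n - b n) mod int n"
proof (rule compatibleI)
  fix a b :: "nat \<Rightarrow> int" and m n :: nat
  assume "compatible a" "compatible b" "n > 0" and d: "int m dvd int n"
  then have "a m = a n mod int m" "b m = b n mod int m"
    by (blast intro: compatibleD)+
  then show "(a m - b m) mod int m = (a n - b n) mod int n mod int m"
    by (simp only: mod_mod_cancel[OF d] mod_diff_eq)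
qed (simp add: compatible_def)

lift_definition uminus_zhat :: "zhat \<Rightarrow> zhat" is "\<lambda>a n. (- a n) mod int n"
proof (rule compatibleI)
  fix a :: "nat \<Rightarrow> int" and m n :: nat
  assume "compatible a" "n > 0" and d: "int m dvd int n"
  then have "a m = a n mod int m"
    by (blast intro: compatibleD)
  then show "(- a m) mod int m = (- a n) mod int n mod int m"
    by (simp only: mod_mod_cancel[OF d] mod_minus_eq)
qed (simp add: compatible_def)

lift_definition times_zhat :: "zhat \<Rightarrow> zhat \<Rightarrow> zhat" is "\<lambda>a b n. (a n * b n) mod int n"
proof (rule compatibleI)
  fix a b :: "nat \<Rightarrow> int" and m n :: nat
  assume "compatible a" "compatible b" "n > 0" and d: "int m dvd int n"
  then have "a m = a n mod int m" "b m = b n mod int m"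
    by (blast intro: compatibleD)+
  then show "(a m * b m) mod int m = (a n * b n) mod int n mod int m"
    by (simp only: mod_mod_cancel[OF d] mod_mult_eq)
qed (simp add: compatible_def)

instance
proof
  fix a b c :: zhat
  show "a * b * c = a * (b * c)"
    by transfer (simp add: fun_eq_iff mod_mult_left_eq mod_mult_right_eq mult.assoc)
  show "a * b = b * a"
    by transfer (simp add: mult.commute)
  show "1 * a = a"
    by transfer (auto simp: fun_eq_iff mod_mult_left_eq compatible_mod compatible_0)
  show "a + b + c = a + (b + c)"
    by transfer (simp add: fun_eq_iff mod_add_left_eq mod_add_right_eq add.assoc)
  show "a + b = b + a"
    by transfer (simp add: add.commute)
  show "0 + a = a"
    by transfer (simp add: fun_eq_iff compatible_mod)
  show "- a + a = 0"
    by transfer (simp add: fun_eq_iff mod_add_left_eq)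
  show "a - b = a + - b"
    by transfer (simp add: fun_eq_iff mod_add_right_eq)
  show "(a + b) * c = a * c + b * c"
    by transfer (simp add: fun_eq_iff mod_mult_left_eq mod_add_eq distrib_right)
  show "(0::zhat) \<noteq> 1"
    by transfer (auto simp: fun_eq_iff intro!: exI[of _ 2])
qed

end

interpretation zhat_tuple: module "\<lambda>(c::zhat) (v::nat \<Rightarrow> zhat) j. c * v j"
  by unfold_locales (simp_all add: fun_eq_iff algebra_simps)

definition N_sub :: "nat \<Rightarrow> (nat \<Rightarrow> zhat) set" where
  "N_sub n = zhat_tuple.span {power_tuple n r | r. r dvd 1}"

definition dtilde :: "nat \<Rightarrow> nat" where
  "dtilde n = (THE d. d > 0 \<and>
     {t :: zhat. (\<lambda>j. if j = n then t else 0) \<in> N_sub (n + 1)} = {t. of_nat d dvd t})"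


section \<open>Degree 0 stable operations on graded K-theory\<close>

text \<open>Over a field of characteristic 0 the additive operations on \<open>K\<^sup>n\<^sub>g\<^sub>r\<close> are identified with
  integral power series, the Adams operation \<open>\<Psi>\<^sub>m\<close> with \<open>(1 - x)\<^sup>m\<close>. The operator \<open>Phi\<close> is
  desuspension, and the degree 0 stable operations are the inverse limit along \<open>Phi\<close>.\<close>

definition Phi :: "int fps \<Rightarrow> int fps" where
  "Phi G = (fps_X - 1) * fps_deriv G"

definition Op_st :: "(nat \<Rightarrow> int fps) set" where
  "Op_st = {G. \<forall>n. G n = Phi (G (Suc n))}"

text \<open>Continuity refers to the metric on formal power series (the \<open>x\<close>-adic topology) and to
  the product topology on functions into the discrete space of integers.\<close>

definition b_map :: "int fps \<Rightarrow> nat \<Rightarrow> int" where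
  "b_map = (THE b. inj b \<and> (\<forall>F G. b (F + G) = b F + b G) \<and> continuous_on UNIV b \<and>
     (\<forall>m::nat. b ((1 - fps_X) ^ m) = (\<lambda>j. int m ^ j)))"

text \<open>As \<open>b_map\<close> is injective, the last condition determines \<open>\<phi>\<close> on \<open>T_Z\<close>.\<close>

definition is_stable_iso :: "((int \<Rightarrow> int) \<Rightarrow> nat \<Rightarrow> int fps) \<Rightarrow> bool" where
  "is_stable_iso \<phi> \<longleftrightarrow> bij_betw \<phi> T_Z Op_st \<and>
     (\<forall>a\<in>T_Z. \<forall>a'\<in>T_Z. \<phi> (a + a') = \<phi> a + \<phi> a') \<and>
     (\<forall>a\<in>T_Z. \<forall>n. b_map (\<phi> a n) = (\<lambda>j. a (int j - int n)))"


section \<open>Termwise infinite sums\<close>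

definition sums_termwise :: "(nat \<Rightarrow> int \<Rightarrow> int) \<Rightarrow> (int \<Rightarrow> int) \<Rightarrow> bool" where
  "sums_termwise F a \<longleftrightarrow>
     (\<forall>j. finite {i. F i j \<noteq> 0} \<and> a j = (\<Sum>i | F i j \<noteq> 0. F i j))"

definition is_leading :: "nat \<Rightarrow> (int \<Rightarrow> int) \<Rightarrow> bool" where
  "is_leading n g \<longleftrightarrow> g \<in> T_Z \<and> (\<forall>j<n. g (int j) = 0) \<and> g (int n) = int (dtilde n)"

end

theory Submission
  imports Defs
begin

text \<open>Over the profinite integers the condition defining \<open>T_Z\<close> becomes symmetric: a sequence is
  in \<open>T_Z\<close> iff all its \<open>n\<close>-intervals lie in \<open>N_sub n\<close>. Indeed \<open>M_sub n\<close> and \<open>N_sub n\<close> contain a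
  positive multiple \<open>D\<close> of every \<open>n\<close>-tuple (Vandermonde), and modulo \<open>D\<close> the tuple
  \<open>r ^ D * (1, r, ..., r ^ (n - 1))\<close> only sees the primes not dividing \<open>r\<close>, so that \<open>r\<close> may be replaced
  by a profinite unit; an interval extends far to the left, which supplies the factor \<open>r ^ D\<close>.
  Since units are invertible, \<open>N_sub\<close> is closed under reversal of tuples, and tuples in it extend
  to longer ones on both sides. A sequence vanishing on an interval of length \<open>n\<close> therefore has
  adjacent entries divisible by \<open>dtilde n\<close>, and this bound is attained by extending
  \<open>(0, ..., 0, dtilde n)\<close>. The expansion follows by clearing the positions 0, 1, -1, 2, -2, ...
  one after the other. The isomorphism rests on the formula that \<open>b_map G j\<close> is the constant
  coefficient of the \<open>j\<close>-fold desuspension of \<open>G\<close>.\<close>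


section \<open>Vandermonde systems\<close>

text \<open>A functional on polynomials of degree at most \<open>n\<close> is reduced to one of degree less than
  \<open>n\<close> by writing \<open>f x = f (r n) + (x - r n) * g x\<close>.\<close>

lemma vandermonde_solution:
  fixes r :: "nat \<Rightarrow> 'a::comm_ring_1"
  assumes "\<And>i j. i < j \<Longrightarrow> j < n \<Longrightarrow> (r i - r j) dvd Q"
  shows "\<exists>c. \<forall>k j. j < n \<longrightarrow> (\<Sum>i<n. c k i * r i ^ j) = (if j = k then Q ^ n else 0)"
  using assms
proof (induction n)
  case 0
  then show ?case by simp
next
  case (Suc n)
  then obtain c where c: "\<And>k j. j < n \<Longrightarrow>
      (\<Sum>i<n. c k i * r i ^ j) = (if j = k then Q ^ n else 0)"
    by (metis less_SucI)
  have "\<forall>i<n. \<exists>q. Q = (r i - r n) * q"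
    using Suc.prems by (meson dvdE lessI)
  then obtain q where q: "\<And>i. i < n \<Longrightarrow> Q = (r i - r n) * q i"
    by metis
  \<comment> \<open>For \<open>f x = f (r n) + (x - r n) * g x\<close> the weights
    \<open>c k\<close> read off \<open>Q ^ n\<close> times the \<open>k\<close>-th coefficient of
    \<open>g\<close>; so the weights \<open>C k\<close> read off \<open>Q ^ n\<close> times the
    \<open>k\<close>-th coefficient of \<open>(x - r n) * g x\<close>.\<close>
  define C where "C k i = (if k = 0 then 0 else c (k - 1) i) - r n * c k i" for k i
  have C: "(\<Sum>i<n. C k i * r i ^ l)
      = (if Suc l = k then Q ^ n else 0) - (if l = k then r n * Q ^ n else 0)" if "l < n" for k l
  proof -
    have "(\<Sum>i<n. C k i * r i ^ l)
        = (if k = 0 then 0 else (\<Sum>i<n. c (k - 1) i * r i ^ l)) - r n * (\<Sum>i<n. c k i * r i ^ l)"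
      by (simp add: C_def algebra_simps sum_subtractf sum_distrib_left)
    then show ?thesis
      using that by (auto simp: c)
  qed
  \<comment> \<open>Since \<open>q i * (f (r i) - f (r n)) = Q * g (r i)\<close>, the weights
    \<open>C k i * q i\<close> turn differences of values of \<open>f\<close> into values of
    \<open>g\<close> at the cost of one factor \<open>Q\<close>. The weight at \<open>r n\<close>
    subtracts \<open>f (r n)\<close> and, for \<open>k = 0\<close>, restores the constant
    term.\<close>
  define d where "d k i = (if i < n then C k i * q i
      else (if k = 0 then Q ^ Suc n else 0) - (\<Sum>i<n. C k i * q i))" for k i
  have "(\<Sum>i<Suc n. d k i * r i ^ j) = (if j = k then Q ^ Suc n else 0)" if "j < Suc n" for k j
  proof -
    have "(\<Sum>i<Suc n. d k i * r i ^ j)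
        = (\<Sum>i<n. C k i * q i * (r i ^ j - r n ^ j)) + (if k = 0 then Q ^ Suc n else 0) * r n ^ j"
      by (simp add: d_def algebra_simps sum_subtractf sum_distrib_left)
    also have "(\<Sum>i<n. C k i * q i * (r i ^ j - r n ^ j))
        = (\<Sum>i<n. \<Sum>l<j. Q * r n ^ (j - Suc l) * (C k i * r i ^ l))"
    proof (rule sum.cong[OF refl])
      fix i assume "i \<in> {..<n}"
      then have *: "Q = (r i - r n) * q i" using q by simp
      have "C k i * q i * (r i ^ j - r n ^ j)
          = C k i * ((r i - r n) * q i) * (\<Sum>l<j. r n ^ (j - Suc l) * r i ^ l)"
        by (simp add: power_diff_sumr2 mult_ac)
      also have "\<dots> = C k i * Q * (\<Sum>l<j. r n ^ (j - Suc l) * r i ^ l)"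
        by (simp only: *[symmetric])
      finally show "C k i * q i * (r i ^ j - r n ^ j)
          = (\<Sum>l<j. Q * r n ^ (j - Suc l) * (C k i * r i ^ l))"
        by (simp only: sum_distrib_left mult_ac)
    qed
    also have "\<dots> = (\<Sum>l<j. Q * r n ^ (j - Suc l) * (\<Sum>i<n. C k i * r i ^ l))"
      by (subst sum.swap) (simp add: sum_distrib_left)
    also have "\<dots> = (\<Sum>l<j. Q * r n ^ (j - Suc l) * (if Suc l = k then Q ^ n else 0))
        - (\<Sum>l<j. Q * r n ^ (j - Suc l) * (if l = k then r n * Q ^ n else 0))"
      using that by (simp add: C right_diff_distrib sum_subtractf)
    also have "(\<Sum>l<j. Q * r n ^ (j - Suc l) * (if l = k then r n * Q ^ n else 0))
        = (if k < j then Q ^ Suc n * r n ^ (j - k) else 0)"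
    proof -
      have "(\<Sum>l<j. Q * r n ^ (j - Suc l) * (if l = k then r n * Q ^ n else 0))
          = (\<Sum>l<j. if l = k then Q ^ Suc n * r n ^ (j - k) else 0)"
        by (rule sum.cong) (auto simp: mult_ac Suc_diff_Suc[symmetric])
      then show ?thesis by simp
    qed
    also have "(\<Sum>l<j. Q * r n ^ (j - Suc l) * (if Suc l = k then Q ^ n else 0))
        = (if 0 < k \<and> k \<le> j then Q ^ Suc n * r n ^ (j - k) else 0)"
    proof -
      have "(\<Sum>l<j. Q * r n ^ (j - Suc l) * (if Suc l = k then Q ^ n else 0))
          = (\<Sum>l<j. if l = k - 1 then (if 0 < k then Q ^ Suc n * r n ^ (j - k) else 0) else 0)"
        by (rule sum.cong) (auto simp: mult_ac)
      then show ?thesis by auto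
    qed
    \<comment> \<open>The two sums over \<open>l\<close> differ only at \<open>j = k\<close>; for
      \<open>k = 0\<close> the first one is 0 and the extra term takes its place.\<close>
    finally show ?thesis
      by (cases "k = 0") (auto simp: mult_ac)
  qed
  then show ?case by blast
qed

lemma sum_fun_apply: "(\<Sum>i\<in>A. f i) x = (\<Sum>i\<in>A. f i x)"
  by (induction A rule: infinite_finite_induct) auto

text \<open>Applied twice: with positive integers as points for \<open>M_sub\<close>, and with
  profinite units for \<open>N_sub\<close>.\<close>

lemma vandermonde_span:
  fixes r v :: "nat \<Rightarrow> 'a::comm_ring_1"
  assumes "\<And>i j. i < j \<Longrightarrow> j < n \<Longrightarrow> (r i - r j) dvd Q" and v: "\<And>j. j \<ge> n \<Longrightarrow> v j = 0"
  shows "\<exists>d. (\<lambda>j. Q ^ n * v j) = (\<Sum>i<n. (\<lambda>j. d i * power_tuple n (r i) j))"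
proof -
  have "\<exists>c. \<forall>k j. j < n \<longrightarrow> (\<Sum>i<n. c k i * r i ^ j) = (if j = k then Q ^ n else 0)"
    by (rule vandermonde_solution) (rule assms(1))
  then obtain c
    where "\<forall>k j. j < n \<longrightarrow> (\<Sum>i<n. c k i * r i ^ j) = (if j = k then Q ^ n else 0)" ..
  note c = this[rule_format]
  define d where "d i = (\<Sum>k<n. v k * c k i)" for i
  have "Q ^ n * v j = (\<Sum>i<n. d i * power_tuple n (r i) j)" for j
  proof (cases "j < n")
    case True
    have "(\<Sum>i<n. d i * power_tuple n (r i) j) = (\<Sum>i<n. \<Sum>k<n. v k * (c k i * r i ^ j))"
      using True by (simp add: d_def power_tuple_def sum_distrib_right mult.assoc)
    also have "\<dots> = (\<Sum>k<n. v k * (\<Sum>i<n. c k i * r i ^ j))"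
      by (subst sum.swap) (simp add: sum_distrib_left)
    also have "\<dots> = (\<Sum>k<n. if j = k then v k * Q ^ n else 0)"
      by (rule sum.cong) (simp_all add: c[OF True] flip: mult.assoc)
    also have "\<dots> = Q ^ n * v j" using True by (simp add: mult.commute)
    finally show ?thesis ..
  qed (simp add: v power_tuple_def)
  then show ?thesis by (intro exI[of _ d]) (simp add: fun_eq_iff sum_fun_apply)
qed

lemma fact_eq_diff_mult:
  assumes "i < j" "j < n"
  obtains k :: int where "fact n = (int i - int j) * k"
proof -
  have "j - i dvd fact n" using assms by (simp add: dvd_fact)
  then obtain k where "fact n = (j - i) * k" by blast
  then have "int (fact n) = int (j - i) * int k" by (simp only: of_nat_mult)
  then have "fact n = (int i - int j) * (- int k)" using assms by (simp add: of_nat_diff algebra_simps)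
  then show ?thesis by (rule that)
qed


section \<open>Profinite integers\<close>

lemma zhat_eqI: "(\<And>n. n > 0 \<Longrightarrow> Rep_zhat x n = Rep_zhat y n) \<Longrightarrow> x = y"
  using Rep_zhat[of x] Rep_zhat[of y]
  by (metis Rep_zhat_inject compatible_0 ext mem_Collect_eq not_gr_zero)

lemma Rep_zhat_0 [simp]: "Rep_zhat x 0 = 0"
  using Rep_zhat[of x] by (simp add: compatible_0)

lemma Rep_zhat_mod [simp]: "Rep_zhat x n mod int n = Rep_zhat x n"
  using Rep_zhat[of x] by (simp add: compatible_mod)

lemma Rep_zhat_mod_dvd: "n > 0 \<Longrightarrow> m dvd n \<Longrightarrow> Rep_zhat x n mod int m = Rep_zhat x m"
  using Rep_zhat[of x] compatibleD[of "Rep_zhat x" n m] by simp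

lemma Rep_zhat_of_nat: "Rep_zhat (of_nat k) n = (if n = 0 then 0 else int k mod int n)"
  by (induction k)
    (auto simp: zero_zhat.rep_eq one_zhat.rep_eq plus_zhat.rep_eq mod_add_eq)

lemma Rep_zhat_of_int: "Rep_zhat (of_int k) n = (if n = 0 then 0 else k mod int n)"
  by (cases k rule: int_diff_cases)
    (auto simp: minus_zhat.rep_eq Rep_zhat_of_nat mod_diff_eq)

lemma of_nat_dvd_zhat_iff:
  assumes "d > 0"
  shows "of_nat d dvd x \<longleftrightarrow> Rep_zhat x d = 0"
proof
  assume "of_nat d dvd x"
  then show "Rep_zhat x d = 0"
    by (elim dvdE) (simp add: times_zhat.rep_eq Rep_zhat_of_nat)
next
  assume 0: "Rep_zhat x d = 0"
  \<comment> \<open>Division by \<open>d\<close> loses a factor \<open>d\<close> of precision, so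
    the component of the quotient at \<open>n\<close> is read off from \<open>x\<close> at the finer
    level \<open>d * n\<close>.\<close>
  define y where "y n = Rep_zhat x (d * n) div int d" for n
  have y: "int d * y n = Rep_zhat x (d * n)" for n
  proof (cases "n = 0")
    case False
    then have "Rep_zhat x (d * n) mod int d = 0"
      using 0 assms Rep_zhat_mod_dvd[of "d * n" d x] by simp
    then show ?thesis unfolding y_def by auto
  qed (simp add: y_def)
  have "compatible y"
  proof (rule compatibleI)
    show "y 0 = 0" by (simp add: y_def)
  next
    fix m n :: nat assume "n > 0" "int m dvd int n"
    then have "Rep_zhat x (d * n) mod int (d * m) = Rep_zhat x (d * m)"
      using assms by (intro Rep_zhat_mod_dvd) auto
    then have "int d * (y n mod int m) = int d * y m"
      by (simp add: y[symmetric] flip: mult_mod_right)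
    then show "y m = y n mod int m" using assms by simp
  qed
  then have rep: "Rep_zhat (Abs_zhat y) = y" by (simp add: Abs_zhat_inverse)
  have "x = of_nat d * Abs_zhat y"
  proof (rule zhat_eqI)
    fix n :: nat assume "n > 0"
    then have "Rep_zhat (of_nat d * Abs_zhat y) n = int d * y n mod int n"
      by (simp add: times_zhat.rep_eq Rep_zhat_of_nat rep mod_mult_left_eq)
    also have "\<dots> = Rep_zhat x n"
      using \<open>n > 0\<close> assms by (simp add: y Rep_zhat_mod_dvd)
    finally show "Rep_zhat x n = Rep_zhat (of_nat d * Abs_zhat y) n" ..
  qed
  then show "of_nat d dvd x" by simp
qed

lemma of_nat_dvd_of_int_zhat: "d > 0 \<Longrightarrow> (of_nat d :: zhat) dvd of_int k \<longleftrightarrow> int d dvd k"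
  by (auto simp: of_nat_dvd_zhat_iff Rep_zhat_of_int)

lemma of_nat_dvd_diff_Rep_zhat:
  assumes "d > 0"
  shows "of_nat d dvd x - of_int (Rep_zhat x d)"
  using assms by (simp add: of_nat_dvd_zhat_iff minus_zhat.rep_eq Rep_zhat_of_int)

section \<open>Idempotents, and units with prescribed local components\<close>

text \<open>By the pigeonhole principle \<open>P ^ a\<close> and \<open>P ^ b\<close> agree modulo \<open>m\<close> for some
  \<open>a < b \<le> m\<close>, and \<open>b - a\<close> divides \<open>fact m\<close>.\<close>

lemma dvd_power_mult_power_fact:
  fixes P m :: nat
  assumes "m > 0"
  shows "int m dvd int P ^ m * (int P ^ fact m - 1)"
proof -
  have "card ((\<lambda>k. P ^ k mod m) ` {..m}) \<le> card {..<m}"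
    using assms by (intro card_mono) auto
  then have "\<not> inj_on (\<lambda>k. P ^ k mod m) {..m}"
    by (intro pigeonhole) simp
  then obtain a b where ab: "a < b" "b \<le> m" "P ^ a mod m = P ^ b mod m"
    unfolding inj_on_def by (metis atMost_iff linorder_neqE_nat)
  have "int m dvd int P ^ b - int P ^ a"
    using ab(3) by (metis mod_eq_dvd_iff of_nat_power zmod_int)
  also have "int P ^ b - int P ^ a = int P ^ a * (int P ^ (b - a) - 1)"
    using ab(1) by (simp add: algebra_simps flip: power_add)
  also have "\<dots> dvd int P ^ m * (int P ^ fact m - 1)"
  proof (rule mult_dvd_mono)
    show "int P ^ a dvd int P ^ m" using ab by (simp add: le_imp_power_dvd)
    have "b - a dvd fact m" using ab by (simp add: dvd_fact)
    then obtain k where "fact m = (b - a) * k" by blast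
    then show "int P ^ (b - a) - 1 dvd int P ^ fact m - 1"
      by (metis dvd_triv_left power_mult power_diff_1_eq)
  qed
  finally show ?thesis .
qed

text \<open>This says that \<open>P ^ fact m\<close> is idempotent modulo \<open>m\<close>; the
  exponent is large enough because \<open>fact m\<close> is at least \<open>m\<close>.\<close>

lemma dvd_power_fact_mult_power_fact:
  fixes P m :: nat
  assumes "m > 0"
  shows "int m dvd int P ^ fact m * (int P ^ fact m - 1)"
  by (rule dvd_trans[OF dvd_power_mult_power_fact[OF assms, of P]])
    (simp add: mult_dvd_mono le_imp_power_dvd fact_ge_self)

text \<open>The idempotent of the profinite integers that is 0 at the primes dividing \<open>P\<close> and 1 at
  the other primes.\<close>

lift_definition idem :: "nat \<Rightarrow> zhat" is
  "\<lambda>P n. if n = 0 then 0 else int P ^ fact n mod int n"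
proof (rule compatibleI)
  fix P m n :: nat assume n: "n > 0" and d: "int m dvd int n"
  then have m: "m > 0" "m \<le> n" by (auto intro: Nat.gr0I dest: dvd_imp_le)
  let ?x = "int P ^ fact m"
  \<comment> \<open>Positive powers of an idempotent are equal, so replacing the exponent
    \<open>fact m\<close> by its multiple \<open>fact n\<close> does not change the residue modulo
    \<open>m\<close>.\<close>
  have idem: "?x ^ Suc k mod int m = ?x mod int m" for k
  proof (induction k)
    case (Suc k)
    have "?x ^ Suc (Suc k) mod int m = (?x * (?x ^ Suc k mod int m)) mod int m"
      by (simp add: mod_mult_right_eq)
    also have "\<dots> = ?x * ?x mod int m"
      by (simp only: Suc.IH mod_mult_right_eq)
    also have "\<dots> = ?x mod int m"
      using dvd_power_fact_mult_power_fact[OF m(1), of P]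
      by (simp add: mod_eq_dvd_iff right_diff_distrib)
    finally show ?case .
  qed simp
  obtain k where k: "fact n = fact m * (k::nat)" using m fact_dvd by blast
  then have "k > 0" by (metis fact_nonzero gr0I mult_0_right)
  then obtain l where "k = Suc l" using gr0_implies_Suc by blast
  then have "int P ^ fact n = ?x ^ Suc l" by (simp only: k power_mult)
  then show "(if m = 0 then 0 else ?x mod int m)
      = (if n = 0 then 0 else int P ^ fact n mod int n) mod int m"
    using m n idem[of l] mod_mod_cancel[OF d, of "?x ^ Suc l"] by simp
qed simp

lemma idem_idem: "idem P * idem P = idem P"
proof (rule zhat_eqI)
  fix n :: nat assume "n > 0"
  then show "Rep_zhat (idem P * idem P) n = Rep_zhat (idem P) n"
    using dvd_power_fact_mult_power_fact[of n P]
    by (simp add: times_zhat.rep_eq idem.rep_eq mod_mult_eq mod_eq_dvd_iff right_diff_distrib)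
qed

lemma of_nat_dvd_idem: "P > 0 \<Longrightarrow> of_nat P dvd idem P"
  by (simp add: of_nat_dvd_zhat_iff idem.rep_eq)

text \<open>At the primes dividing \<open>P\<close> the exponent \<open>D\<close> exceeds the
  valuation of \<open>D\<close>; at the other primes \<open>1 - idem P\<close> is 0.\<close>

lemma of_nat_dvd_power_mult_idem:
  assumes "D > 0"
  shows "of_nat D dvd (of_nat P ^ D * (1 - idem P) :: zhat)"
proof -
  have "Rep_zhat (of_nat P ^ D * (1 - idem P)) D
      = int P ^ D * (1 - int P ^ fact D) mod int D"
    using assms
    by (simp add: times_zhat.rep_eq minus_zhat.rep_eq one_zhat.rep_eq idem.rep_eq
        Rep_zhat_of_nat mod_mult_eq mod_diff_eq flip: of_nat_power)
  also have "\<dots> = 0"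
    using dvd_power_mult_power_fact[OF assms, of P]
    by (metis dvd_imp_mod_0 dvd_minus_iff minus_diff_eq mult_minus_right)
  finally show ?thesis using assms by (simp add: of_nat_dvd_zhat_iff)
qed

text \<open>No prime divides both numbers, so at each prime one of the two factors is 0.\<close>

lemma idem_coprime:
  assumes "coprime P b"
  shows "(1 - idem P) * (1 - idem b) = 0"
proof (rule zhat_eqI)
  fix n :: nat assume n: "n > 0"
  define x y where "x = int P ^ fact n" and "y = int b ^ fact n"
  have "coprime x y" using assms by (simp add: x_def y_def)
  then obtain u v where uv: "u * x + v * y = 1"
    by (metis bezout_int coprime_imp_gcd_eq_1)
  have "int n dvd x * (x - 1)" "int n dvd y * (y - 1)"
    using n dvd_power_fact_mult_power_fact unfolding x_def y_def by blast+
  \<comment> \<open>Multiplying \<open>(1 - x) * (1 - y)\<close> by the Bezout combination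
    \<open>u * x + v * y = 1\<close> makes \<open>x * (x - 1)\<close> or \<open>y * (y - 1)\<close>
    appear in each summand.\<close>
  then have "int n dvd u * (y - 1) * (x * (x - 1)) + v * (x - 1) * (y * (y - 1))"
    by simp
  also have "\<dots> = (u * x + v * y) * ((1 - x) * (1 - y))" by (simp add: algebra_simps)
  finally have "(1 - x) * (1 - y) mod int n = 0" by (simp only: uv) simp
  moreover have "Rep_zhat ((1 - idem P) * (1 - idem b)) n = (1 - x) * (1 - y) mod int n"
    using n mod_mult_eq[of "1 mod int n - x mod int n" "int n" "1 mod int n - y mod int n"]
      mod_mult_eq[of "1 - x" "int n" "1 - y"]
    by (simp add: times_zhat.rep_eq minus_zhat.rep_eq one_zhat.rep_eq idem.rep_eq
        mod_diff_eq flip: x_def y_def)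
  ultimately show "Rep_zhat ((1 - idem P) * (1 - idem b)) n = Rep_zhat 0 n"
    by (simp add: zero_zhat.rep_eq)
qed

text \<open>The profinite integer that is \<open>b\<close> at the primes dividing \<open>P\<close>
  and \<open>a\<close> at the others.\<close>

definition mix :: "nat \<Rightarrow> nat \<Rightarrow> nat \<Rightarrow> zhat" where
  "mix P a b = idem P * of_nat a + (1 - idem P) * of_nat b"

text \<open>At the primes not dividing \<open>P\<close> the divisor \<open>a\<close> of
  \<open>P\<close> is invertible; at the primes dividing \<open>P\<close> the number
  \<open>b\<close>, coprime to \<open>P\<close>, is.\<close>

lemma mix_unit:
  assumes "P > 0" "a dvd P" "coprime P b" "b > 0"
  shows "mix P a b dvd 1"
proof -
  let ?e = "idem P"
  obtain a' where "P = a * a'"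
    using assms(2) by blast
  then have "of_nat a dvd ?e"
    using of_nat_dvd_idem[OF assms(1)] by (simp add: dvd_mult_left)
  then obtain w where w: "?e = of_nat a * w" by blast
  obtain q where q: "idem b = of_nat b * q"
    using of_nat_dvd_idem[OF assms(4)] by blast
  have ee: "?e * (1 - ?e) = 0" "(1 - ?e) * (1 - ?e) = 1 - ?e" "?e * ?e = ?e"
    using idem_idem[of P] by (simp_all add: algebra_simps)
  \<comment> \<open>The inverse is glued from \<open>w\<close>, which inverts \<open>a\<close> where
    \<open>idem P\<close> is 1, and \<open>q\<close>, which inverts \<open>b\<close> where
    \<open>idem P\<close> is 0, since \<open>idem b\<close> is 1 there.\<close>
  have "mix P a b * (?e * w + (1 - ?e) * q)
      = (?e * ?e) * (of_nat a * w) + ((1 - ?e) * (1 - ?e)) * (of_nat b * q)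
        + (?e * (1 - ?e)) * (of_nat a * q + of_nat b * w)"
    unfolding mix_def by (simp only: algebra_simps)
  also have "\<dots> = ?e + (1 - ?e) * idem b"
    by (simp only: ee w[symmetric] q[symmetric]) simp
  also have "\<dots> = 1 - (1 - ?e) * (1 - idem b)" by (simp add: algebra_simps)
  also have "\<dots> = 1" using idem_coprime[OF assms(3)] by simp
  finally show ?thesis by (metis dvd_triv_left)
qed

lemma idem_mult_mix_power: "idem P * mix P a b ^ j = idem P * of_nat a ^ j"
proof (induction j)
  case (Suc j)
  have "idem P * mix P a b = idem P * of_nat a"
    using idem_idem[of P] by (simp add: mix_def algebra_simps flip: mult.assoc)
  then show ?case
    by (metis Suc.IH mult.assoc mult.commute power_Suc2)
qed simp


section \<open>The integral span\<close>

lemma M_sub_zero: "0 \<in> M_sub n"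
  by (simp add: M_sub_def)

lemma M_sub_diff: "v \<in> M_sub n \<Longrightarrow> w \<in> M_sub n \<Longrightarrow> v - w \<in> M_sub n"
  by (simp add: M_sub_def group_closure.diff)

lemma M_sub_add: "v \<in> M_sub n \<Longrightarrow> w \<in> M_sub n \<Longrightarrow> v + w \<in> M_sub n"
  by (simp add: M_sub_def group_closure_add)

lemma M_sub_power_tuple: "r > 0 \<Longrightarrow> power_tuple n r \<in> M_sub n"
  by (auto simp: M_sub_def intro!: group_closure.base)

lemma M_sub_scale:
  assumes "v \<in> M_sub n"
  shows "(\<lambda>j. c * v j) \<in> M_sub n"
proof (cases c rule: int_diff_cases)
  case (diff k l)
  have nat: "(\<lambda>j. int m * v j) \<in> M_sub n" for m
  proof (induction m)
    case (Suc m)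
    show ?case using M_sub_add[OF Suc.IH assms] by (simp add: plus_fun_def algebra_simps)
  qed (use M_sub_zero[of n] in \<open>simp add: zero_fun_def\<close>)
  show ?thesis
    using M_sub_diff[OF nat[of k] nat[of l]] by (simp add: diff fun_diff_def algebra_simps)
qed

lemma M_sub_sum: "(\<And>i. i \<in> A \<Longrightarrow> f i \<in> M_sub n) \<Longrightarrow> (\<Sum>i\<in>A. f i) \<in> M_sub n"
  by (induction A rule: infinite_finite_induct) (auto simp: M_sub_zero M_sub_add)

lemma M_sub_lattice:
  "\<exists>D::nat. D > 0 \<and> (\<forall>v. (\<forall>j\<ge>n. v j = 0) \<longrightarrow> (\<lambda>j. int D * v j) \<in> M_sub n)"
proof (intro exI conjI allI impI)
  show "(fact n :: nat) ^ n > 0" by simp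
next
  fix v :: "nat \<Rightarrow> int" assume "\<forall>j\<ge>n. v j = 0"
  then have v: "\<And>j. j \<ge> n \<Longrightarrow> v j = 0" by blast
  \<comment> \<open>The points are \<open>1, ..., n\<close> rather than \<open>0, ..., n - 1\<close>
    because generators of \<open>M_sub\<close> have positive base.\<close>
  have diff: "(int (Suc i) - int (Suc j)) dvd fact n" if "i < j" "j < n" for i j
    using fact_eq_diff_mult[OF that] by (metis add_diff_cancel_left dvd_triv_left of_nat_Suc)
  have "\<exists>d. (\<lambda>j. fact n ^ n * v j) = (\<Sum>i<n. (\<lambda>j. d i * power_tuple n (int (Suc i)) j))"
    by (rule vandermonde_span) (rule diff v, assumption+)+
  then obtain d
    where d: "(\<lambda>j. fact n ^ n * v j) = (\<Sum>i<n. (\<lambda>j. d i * power_tuple n (int (Suc i)) j))" ..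
  have "(\<lambda>j. fact n ^ n * v j) \<in> M_sub n"
    unfolding d by (intro M_sub_sum M_sub_scale M_sub_power_tuple) simp
  then show "(\<lambda>j. int (fact n ^ n) * v j) \<in> M_sub n" by simp
qed


section \<open>The profinite span\<close>

lemma N_sub_zero: "(\<lambda>_. 0) \<in> N_sub n"
  using zhat_tuple.span_zero unfolding N_sub_def zero_fun_def .

lemma N_sub_add: "v \<in> N_sub n \<Longrightarrow> w \<in> N_sub n \<Longrightarrow> (\<lambda>j. v j + w j) \<in> N_sub n"
  using zhat_tuple.span_add[of v _ w] unfolding N_sub_def plus_fun_def .

lemma N_sub_diff: "v \<in> N_sub n \<Longrightarrow> w \<in> N_sub n \<Longrightarrow> (\<lambda>j. v j - w j) \<in> N_sub n"
  using zhat_tuple.span_diff[of v _ w] unfolding N_sub_def fun_diff_def .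

lemma N_sub_scale: "v \<in> N_sub n \<Longrightarrow> (\<lambda>j. c * v j) \<in> N_sub n"
  unfolding N_sub_def by (rule zhat_tuple.span_scale)

lemma N_sub_sum: "(\<And>i. i \<in> A \<Longrightarrow> f i \<in> N_sub n) \<Longrightarrow> (\<Sum>i\<in>A. f i) \<in> N_sub n"
  unfolding N_sub_def by (rule zhat_tuple.span_sum)

lemma N_sub_power_tuple: "r dvd 1 \<Longrightarrow> power_tuple n r \<in> N_sub n"
  unfolding N_sub_def by (rule zhat_tuple.span_base) blast

lemma N_sub_induct [consumes 1, case_names zero step]:
  assumes "v \<in> N_sub n"
    and "P (\<lambda>_. 0)"
    and "\<And>c r v. r dvd 1 \<Longrightarrow> P v \<Longrightarrow> P (\<lambda>j. c * power_tuple n r j + v j)"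
  shows "P v"
  using assms(1) unfolding N_sub_def
proof (induction rule: zhat_tuple.span_induct_alt)
  case base
  show ?case using assms(2) by (simp add: zero_fun_def)
next
  case (step c x y)
  then show ?case using assms(3) by (auto simp: plus_fun_def)
qed

lemma N_sub_support: "v \<in> N_sub n \<Longrightarrow> j \<ge> n \<Longrightarrow> v j = 0"
  by (induction rule: N_sub_induct) (auto simp: power_tuple_def)

text \<open>The points \<open>mix (fact n) (i + 1) (1 + fact n * i)\<close> are units whose differences divide
  a positive integer.\<close>

lemma N_sub_lattice:
  "\<exists>D::nat. D > 0 \<and> (\<forall>v. (\<forall>j\<ge>n. v j = 0) \<longrightarrow> (\<lambda>j. of_nat D * v j) \<in> N_sub n)"
proof (intro exI conjI allI impI)
  show "(fact n * fact n :: nat) ^ n > 0" by simp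
next
  fix v :: "nat \<Rightarrow> zhat" assume "\<forall>j\<ge>n. v j = 0"
  then have v: "\<And>j. j \<ge> n \<Longrightarrow> v j = 0" by blast
  define P :: nat where "P = fact n"
  define e where "e = idem P"
  define r where "r i = mix P (Suc i) (Suc (P * i))" for i
  have ee: "e * e = e" by (simp add: e_def idem_idem)
  have unit: "r i dvd 1" if "i < n" for i
    unfolding r_def
  proof (rule mix_unit)
    show "Suc i dvd P" using that by (simp add: P_def dvd_fact)
    show "coprime P (Suc (P * i))"
      by (metis coprime_1_right coprime_iff_gcd_eq_1 gcd_add_mult add.commute mult.commute plus_1_eq_Suc)
  qed (simp_all add: P_def)
  have diff: "(r i - r j) dvd of_nat (P * P)" if ij: "i < j" "j < n" for i j
  proof -
    obtain k :: int where "fact n = (int i - int j) * k"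
      by (rule fact_eq_diff_mult[OF ij])
    then have k: "int P = (int i - int j) * k"
      by (simp add: P_def)
    have k': "of_nat P = (of_nat i - of_nat j) * (of_int k :: zhat)"
      using arg_cong[OF k, of "of_int :: int \<Rightarrow> zhat"] by simp
    \<comment> \<open>The difference is \<open>i - j\<close> where \<open>e\<close> is 1 and
      \<open>(i - j) * P\<close> where \<open>e\<close> is 0. The complementary factor
      \<open>e * P + (1 - e)\<close> evens this out to \<open>(i - j) * P\<close>, and
      \<open>k\<close> turns \<open>i - j\<close> into \<open>P\<close>.\<close>
    have "r i - r j = (of_nat i - of_nat j) * (e + (1 - e) * of_nat P)"
      unfolding r_def mix_def e_def by (simp add: algebra_simps)
    then have "(r i - r j) * (of_int k * (e * of_nat P + (1 - e)))
        = of_nat P * ((e + (1 - e) * of_nat P) * (e * of_nat P + (1 - e)))"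
      by (simp add: k' mult_ac)
    also have "(e + (1 - e) * of_nat P) * (e * of_nat P + (1 - e))
        = (e * e) * of_nat P + (1 - 2 * e + e * e) * of_nat P
          + (e - e * e) * (1 + of_nat P * of_nat P)"
      by (simp add: algebra_simps)
    also have "\<dots> = of_nat P" by (simp only: ee) (simp add: algebra_simps)
    finally show ?thesis by (metis dvd_triv_left of_nat_mult)
  qed
  have "\<exists>d. (\<lambda>j. of_nat (P * P) ^ n * v j) = (\<Sum>i<n. (\<lambda>j. d i * power_tuple n (r i) j))"
    by (rule vandermonde_span) (rule diff v, assumption+)+
  then obtain d
    where d: "(\<lambda>j. of_nat (P * P) ^ n * v j) = (\<Sum>i<n. (\<lambda>j. d i * power_tuple n (r i) j))" ..
  have "(\<lambda>j. of_nat (P * P) ^ n * v j) \<in> N_sub n"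
    unfolding d by (intro N_sub_sum N_sub_scale N_sub_power_tuple unit) simp
  then show "(\<lambda>j. of_nat ((fact n * fact n) ^ n) * v j) \<in> N_sub n"
    by (simp add: P_def)
qed

text \<open>Reversal sends the power tuple of a unit \<open>r\<close> to \<open>r ^ (n - 1)\<close>
  times the power tuple of its inverse.\<close>

lemma N_sub_reverse:
  assumes "v \<in> N_sub n"
  shows "(\<lambda>j. if j < n then v (n - 1 - j) else 0) \<in> N_sub n"
  using assms
proof (induction rule: N_sub_induct)
  case (step c r v)
  then obtain s where s: "r * s = 1" by (metis dvdE)
  have pow: "r ^ (n - 1 - j) = r ^ (n - 1) * s ^ j" if "j < n" for j
  proof -
    have "r ^ (n - 1) * s ^ j = r ^ (n - 1 - j) * (r * s) ^ j"
      using that by (simp add: power_mult_distrib mult.assoc[symmetric] flip: power_add)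
    then show ?thesis by (simp add: s)
  qed
  have "(\<lambda>j. if j < n then c * power_tuple n r (n - 1 - j) + v (n - 1 - j) else 0)
      = (\<lambda>j. (c * r ^ (n - 1)) * power_tuple n s j + (if j < n then v (n - 1 - j) else 0))"
  proof
    fix j
    show "(if j < n then c * power_tuple n r (n - 1 - j) + v (n - 1 - j) else 0)
      = (c * r ^ (n - 1)) * power_tuple n s j + (if j < n then v (n - 1 - j) else 0)"
    proof (cases "j < n")
      case True
      then have "power_tuple n r (n - 1 - j) = r ^ (n - 1) * power_tuple n s j"
        using pow[OF True] by (simp only: power_tuple_def) simp
      then show ?thesis using True by (simp add: mult.assoc)
    qed (simp add: power_tuple_def)
  qed
  moreover have "s dvd 1" using s by (metis dvd_triv_right)
  ultimately show ?case
    using step.IH by (auto intro!: N_sub_add N_sub_scale N_sub_power_tuple)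
qed (simp add: N_sub_zero)

lemma N_sub_drop:
  assumes "v \<in> N_sub (n + k)"
  shows "(\<lambda>j. if j < n then v (j + k) else 0) \<in> N_sub n"
  using assms
proof (induction rule: N_sub_induct)
  case (step c r v)
  have "(\<lambda>j. if j < n then c * power_tuple (n + k) r (j + k) + v (j + k) else 0)
      = (\<lambda>j. (c * r ^ k) * power_tuple n r j + (if j < n then v (j + k) else 0))"
    by (auto simp: power_tuple_def fun_eq_iff power_add mult_ac)
  then show ?case
    using step by (auto intro!: N_sub_add N_sub_scale N_sub_power_tuple)
qed (simp add: N_sub_zero)

lemma N_sub_take:
  assumes "v \<in> N_sub (n + k)"
  shows "(\<lambda>j. if j < n then v j else 0) \<in> N_sub n"
  using assms
proof (induction rule: N_sub_induct)
  case (step c r v)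
  have "(\<lambda>j. if j < n then c * power_tuple (n + k) r j + v j else 0)
      = (\<lambda>j. c * power_tuple n r j + (if j < n then v j else 0))"
    by (auto simp: power_tuple_def fun_eq_iff)
  then show ?case
    using step by (auto intro!: N_sub_add N_sub_scale N_sub_power_tuple)
qed (simp add: N_sub_zero)

text \<open>Each generator continues to a longer generator, and a combination is continued with the
  same coefficients.\<close>

lemma N_sub_extend:
  assumes "v \<in> N_sub n"
  shows "\<exists>w\<in>N_sub (Suc n). \<forall>j<n. w j = v j"
  using assms
proof (induction rule: N_sub_induct)
  case zero
  show ?case by (intro bexI[OF _ N_sub_zero]) simp
next
  case (step c r v)
  then obtain w where "w \<in> N_sub (Suc n)" "\<forall>j<n. w j = v j" by blast
  moreover from this have "(\<lambda>j. c * power_tuple (Suc n) r j + w j) \<in> N_sub (Suc n)"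
    using step.hyps by (intro N_sub_add N_sub_scale N_sub_power_tuple)
  ultimately show ?case
    by (intro bexI[of _ "\<lambda>j. c * power_tuple (Suc n) r j + w j"]) (simp_all add: power_tuple_def)
qed

section \<open>Comparison of the integral and the profinite span\<close>

text \<open>The factor \<open>r ^ D\<close> kills, modulo \<open>D\<close>, the components at the primes dividing \<open>r\<close>, and at the
  other primes \<open>r\<close> agrees with the unit \<open>mix r r 1\<close>.\<close>

lemma M_sub_drop_in_N_sub:
  "\<exists>k. \<forall>v\<in>M_sub (n + k). (\<lambda>j. if j < n then of_int (v (j + k)) else 0) \<in> N_sub n"
proof -
  obtain D where D: "D > 0"
      "\<And>v. \<forall>j\<ge>n. v j = 0 \<Longrightarrow> (\<lambda>j. of_nat D * v j) \<in> N_sub n"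
    using N_sub_lattice[of n] by blast
  have "(\<lambda>j. if j < n then of_int (v (j + D)) else 0) \<in> N_sub n" if "v \<in> M_sub (n + D)" for v
    using that unfolding M_sub_def
  proof (induction rule: group_closure.induct)
    case (base s)
    show ?case
    proof (cases "s = 0")
      case False
      with base obtain r :: int where r: "r > 0" "s = power_tuple (n + D) r" by blast
      define m where "m = nat r"
      have m: "m > 0" "of_int r = (of_nat m :: zhat)"
        using r(1) by (simp_all add: m_def)
      define e u where "e = idem m" and "u = mix m m 1"
      have u: "u dvd 1" unfolding u_def using m by (intro mix_unit) auto
      have eu: "e * of_nat m ^ j = e * u ^ j" for j
        by (simp add: e_def u_def idem_mult_mix_power)
      obtain y where y: "of_nat m ^ D * (1 - e) = of_nat D * y"
        using of_nat_dvd_power_mult_idem[OF D(1), of m] by (auto simp: e_def)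
      \<comment> \<open>Split by \<open>e\<close>: the part at \<open>1 - e\<close> is a multiple of
        \<open>D\<close>, hence in \<open>N_sub n\<close> whatever its entries are; in the part at
        \<open>e\<close> the powers of \<open>m\<close> become powers of the unit
        \<open>u\<close>.\<close>
      have "of_int (r ^ (j + D)) = of_nat D * (y * of_nat m ^ j) + (of_nat m ^ D * e) * u ^ j" for j
      proof -
        have "of_int (r ^ (j + D))
            = of_nat m ^ D * (1 - e) * of_nat m ^ j + of_nat m ^ D * (e * of_nat m ^ j)"
          by (simp add: m(2) power_add algebra_simps)
        then show ?thesis by (simp add: y eu mult.assoc)
      qed
      then have "(\<lambda>j. if j < n then of_int (s (j + D)) else 0)
          = (\<lambda>j. of_nat D * (if j < n then y * of_nat m ^ j else 0)
              + (of_nat m ^ D * e) * power_tuple n u j)"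
        by (auto simp: fun_eq_iff r(2) power_tuple_def)
      then show ?thesis
        using u by (auto intro!: N_sub_add N_sub_scale[of "power_tuple n u"] N_sub_power_tuple D(2))
    qed (auto simp: N_sub_zero cong: if_cong)
  next
    case (diff s t)
    show ?case using N_sub_diff[OF diff.IH] by (simp add: if_distrib cong: if_cong)
  qed
  then show ?thesis by blast
qed

text \<open>Modulo \<open>D\<close>, coefficients and units may be replaced by integers; the error
  is a multiple of \<open>D\<close>, and such tuples lie in \<open>M_sub n\<close>.\<close>

lemma N_sub_imp_M_sub:
  assumes N: "(\<lambda>j. of_int (v j)) \<in> N_sub n" and supp: "\<And>j. j \<ge> n \<Longrightarrow> v j = 0"
  shows "v \<in> M_sub n"
proof -
  obtain D where D: "D > 0"
      "\<And>v. \<forall>j\<ge>n. v j = 0 \<Longrightarrow> (\<lambda>j. int D * v j) \<in> M_sub n"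
    using M_sub_lattice[of n] by blast
  have "\<exists>u\<in>M_sub n. \<forall>j. Rep_zhat (w j) D = u j mod int D" if "w \<in> N_sub n" for w
    using that
  proof (induction rule: N_sub_induct)
    case zero
    show ?case using M_sub_zero by (intro bexI[of _ 0]) (simp_all add: zero_zhat.rep_eq)
  next
    case (step c r w)
    then obtain u where u: "u \<in> M_sub n" "\<And>j. Rep_zhat (w j) D = u j mod int D" by blast
    \<comment> \<open>Adding \<open>D\<close> keeps the residue and makes the base positive; the
      canonical representative is 0 if \<open>D = 1\<close>.\<close>
    define m where "m = Rep_zhat r D + int D"
    have "Rep_zhat r D mod int D \<ge> 0" using D(1) by (intro pos_mod_sign) simp
    then have "m > 0" using D(1) by (simp add: m_def)
    have pow: "Rep_zhat (r ^ j) D = m ^ j mod int D" for j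
    proof (induction j)
      case (Suc j)
      have "Rep_zhat r D = m mod int D" by (simp add: m_def)
      then show ?case using Suc by (simp add: times_zhat.rep_eq mod_mult_eq)
    qed (use D(1) in \<open>simp add: one_zhat.rep_eq\<close>)
    have "Rep_zhat (c * power_tuple n r j + w j) D
        = (Rep_zhat c D * power_tuple n m j + u j) mod int D" for j
    proof (cases "j < n")
      case True
      have "(Rep_zhat c D * (m ^ j mod int D) + u j) mod int D
          = (Rep_zhat c D * m ^ j + u j) mod int D"
        by (metis mod_add_left_eq mod_mult_right_eq)
      then show ?thesis
        using u(2) pow True
        by (simp add: plus_zhat.rep_eq times_zhat.rep_eq power_tuple_def mod_add_eq)
    qed (use u(2) in \<open>simp add: plus_zhat.rep_eq times_zhat.rep_eq power_tuple_def zero_zhat.rep_eq\<close>)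
    then show ?case
      using M_sub_add[OF M_sub_scale[OF M_sub_power_tuple[OF \<open>m > 0\<close>, of n], of "Rep_zhat c D"] u(1)]
      by (intro bexI[of _ "(\<lambda>j. Rep_zhat c D * power_tuple n m j) + u"]) auto
  qed
  from this[OF N] obtain u where u: "u \<in> M_sub n" "\<And>j. v j mod int D = u j mod int D"
    using D(1) by (auto simp: Rep_zhat_of_int)
  have supp_u: "u j = 0" if "j \<ge> n" for j
    using u(1) that unfolding M_sub_def
    by (induction rule: group_closure.induct) (auto simp: power_tuple_def)
  have "v j = int D * ((v j - u j) div int D) + u j" for j
    using u(2)[of j] by (simp add: mod_eq_dvd_iff)
  then have "v = (\<lambda>j. int D * ((v j - u j) div int D)) + u"
    by (simp add: fun_eq_iff)
  also have "\<dots> \<in> M_sub n"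
    by (intro M_sub_add D(2) u(1)) (simp add: supp supp_u)
  finally show ?thesis .
qed

definition interval_hat :: "nat \<Rightarrow> (int \<Rightarrow> int) \<Rightarrow> int \<Rightarrow> nat \<Rightarrow> zhat" where
  "interval_hat n a i = (\<lambda>j. if j < n then of_int (a (i + int j)) else 0)"

lemma T_Z_iff: "a \<in> T_Z \<longleftrightarrow> (\<forall>n i. interval_hat n a i \<in> N_sub n)"
proof
  assume a: "a \<in> T_Z"
  show "\<forall>n i. interval_hat n a i \<in> N_sub n"
  proof (intro allI)
    fix n i
    obtain k where k: "\<And>v. v \<in> M_sub (n + k) \<Longrightarrow>
        (\<lambda>j. if j < n then of_int (v (j + k)) else 0) \<in> N_sub n"
      using M_sub_drop_in_N_sub[of n] by blast
    show "interval_hat n a i \<in> N_sub n"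
    proof (cases "n = 0")
      case True
      then show ?thesis by (simp add: interval_hat_def N_sub_zero)
    next
      case False
      \<comment> \<open>The \<open>n\<close>-interval at \<open>i\<close> is the end of the
        \<open>(n + k)\<close>-interval that starts \<open>k\<close> places earlier.\<close>
      then have "interval_at (n + k) a (i - int k) \<in> M_sub (n + k)"
        using a by (simp add: T_Z_def)
      from k[OF this] show ?thesis
        by (simp add: interval_hat_def interval_at_def algebra_simps cong: if_cong)
    qed
  qed
next
  assume *: "\<forall>n i. interval_hat n a i \<in> N_sub n"
  have "interval_at n a i \<in> M_sub n" for n i
  proof (rule N_sub_imp_M_sub)
    have "(\<lambda>j. of_int (interval_at n a i j)) = interval_hat n a i"
      by (auto simp: interval_at_def interval_hat_def)
    then show "(\<lambda>j. of_int (interval_at n a i j)) \<in> N_sub n"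
      using * by simp
  qed (simp add: interval_at_def)
  then show "a \<in> T_Z" by (simp add: T_Z_def)
qed


section \<open>The divisors of leading coefficients\<close>

text \<open>The ideal \<open>I\<close> contains a positive integer by \<open>N_sub_lattice\<close>.
  The least one, \<open>d\<close>, generates \<open>I\<close>: every profinite integer is an integer
  modulo \<open>d\<close>, and for integers division with remainder applies.\<close>

lemma dtilde_spec:
  "dtilde n > 0 \<and>
    (\<forall>t. (\<lambda>j. if j = n then t else 0) \<in> N_sub (Suc n) \<longleftrightarrow> of_nat (dtilde n) dvd t)"
proof -
  define I where "I = {t :: zhat. (\<lambda>j. if j = n then t else 0) \<in> N_sub (n + 1)}"
  have I_scale: "c * t \<in> I" if "t \<in> I" for c t
    using N_sub_scale[of "\<lambda>j. if j = n then t else 0" "n + 1" c] that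
    by (simp add: I_def if_distrib cong: if_cong)
  have I_diff: "s - t \<in> I" if "s \<in> I" "t \<in> I" for s t
  proof -
    have "(\<lambda>j. (if j = n then s else 0) - (if j = n then t else 0)) = (\<lambda>j. if j = n then s - t else 0)"
      by auto
    then show ?thesis
      using N_sub_diff[of "\<lambda>j. if j = n then s else 0" "n + 1" "\<lambda>j. if j = n then t else 0"] that
      by (simp add: I_def)
  qed
  have "\<exists>D. D > 0 \<and> of_nat D \<in> I"
  proof -
    obtain D where D: "D > 0"
        "\<And>v. \<forall>j\<ge>Suc n. v j = 0 \<Longrightarrow> (\<lambda>j. of_nat D * v j) \<in> N_sub (Suc n)"
      using N_sub_lattice[of "Suc n"] by blast
    from D(2)[of "\<lambda>j. if j = n then 1 else 0"] have "of_nat D \<in> I"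
      by (simp add: I_def if_distrib cong: if_cong)
    then show ?thesis using D(1) by blast
  qed
  then obtain d where d: "d > 0" "of_nat d \<in> I"
    and least: "\<And>e. e > 0 \<Longrightarrow> of_nat e \<in> I \<Longrightarrow> d \<le> e"
    using exists_least_iff[of "\<lambda>d. d > 0 \<and> of_nat d \<in> I"] by (meson not_le)
  have int_I: "int d dvd k" if "of_int k \<in> I" for k
  proof -
    define e where "e = nat (k mod int d)"
    have e: "int e = k mod int d" using d(1) by (simp add: e_def)
    have "of_int k - of_int (k div int d) * of_nat d = (of_nat e :: zhat)"
      by (metis e minus_div_mult_eq_mod of_int_diff of_int_mult of_int_of_nat_eq)
    then have "of_nat e \<in> I" using I_diff[OF that I_scale[OF d(2)]] by metis
    moreover have "e < d" using e d(1) by (metis of_nat_0_less_iff of_nat_less_iff pos_mod_bound)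
    ultimately have "e = 0" using least by force
    then show ?thesis using e by auto
  qed
  have I: "I = {t. of_nat d dvd t}"
  proof (intro equalityI subsetI)
    fix t assume t: "t \<in> I"
    obtain y where y: "t - of_int (Rep_zhat t d) = of_nat d * y"
      using of_nat_dvd_diff_Rep_zhat[OF d(1)] by blast
    then have "of_int (Rep_zhat t d) = t - y * of_nat d" by (simp add: algebra_simps)
    then have "int d dvd Rep_zhat t d" using int_I I_diff[OF t I_scale[OF d(2)]] by metis
    moreover have "of_nat d dvd t \<longleftrightarrow> Rep_zhat t d = 0"
      using d(1) by (rule of_nat_dvd_zhat_iff)
    ultimately show "t \<in> {t. of_nat d dvd t}"
      by (metis Rep_zhat_mod dvd_imp_mod_0 mem_Collect_eq)
  next
    fix t :: zhat assume "t \<in> {t. of_nat d dvd t}"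
    then show "t \<in> I" using I_scale[OF d(2)] by (auto simp: mult.commute elim!: dvdE)
  qed
  have "dtilde n = d"
    unfolding dtilde_def
  proof (rule the_equality)
    show "d > 0 \<and> {t. (\<lambda>j. if j = n then t else 0) \<in> N_sub (n + 1)} = {t. of_nat d dvd t}"
      using d(1) I by (simp add: I_def)
  next
    fix e assume e: "e > 0 \<and> {t. (\<lambda>j. if j = n then t else 0) \<in> N_sub (n + 1)} = {t. of_nat e dvd t}"
    then have *: "of_nat d dvd t \<longleftrightarrow> of_nat e dvd t" for t :: zhat
      using I unfolding I_def by blast
    have "int d dvd int e"
      using *[of "of_nat e"] of_nat_dvd_of_int_zhat[OF d(1), of "int e"] by simp
    moreover have "int e dvd int d"
      using *[of "of_nat d"] of_nat_dvd_of_int_zhat[of e "int d"] e by simp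
    ultimately show "e = d" by (simp add: dvd_antisym)
  qed
  then show ?thesis using d(1) I by (auto simp: I_def)
qed

lemma dtilde_pos: "dtilde n > 0"
  using dtilde_spec by blast

lemma single_in_N_sub_iff:
  "(\<lambda>j. if j = n then t else 0) \<in> N_sub (Suc n) \<longleftrightarrow> of_nat (dtilde n) dvd t"
  using dtilde_spec by blast


section \<open>Intervals of stable sequences\<close>

lemma interval_hat_shift: "interval_hat n (\<lambda>j. a (j + k)) i = interval_hat n a (i + k)"
  by (auto simp: interval_hat_def fun_eq_iff ac_simps)

lemma interval_hat_reflect:
  assumes "interval_hat n a (k - i - int n + 1) \<in> N_sub n"
  shows "interval_hat n (\<lambda>j. a (k - j)) i \<in> N_sub n"
proof -
  have "interval_hat n (\<lambda>j. a (k - j)) i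
      = (\<lambda>j. if j < n then interval_hat n a (k - i - int n + 1) (n - 1 - j) else 0)"
    by (auto simp: interval_hat_def fun_eq_iff of_nat_diff algebra_simps)
  then show ?thesis using N_sub_reverse[OF assms] by simp
qed

lemma interval_hat_subinterval:
  assumes "interval_hat N a k \<in> N_sub N" "k \<le> i" "i + int n \<le> k + int N"
  shows "interval_hat n a i \<in> N_sub n"
proof -
  define l m where "l = nat (i - k)" and "m = nat (k + int N - i - int n)"
  have N: "N = (n + m) + l" and i: "i = k + int l" using assms by (auto simp: l_def m_def)
  have "(\<lambda>j. if j < n + m then interval_hat N a k (j + l) else 0) \<in> N_sub (n + m)"
    using assms(1) unfolding N by (rule N_sub_drop)
  from N_sub_take[OF this] show ?thesis
    by (simp add: interval_hat_def N i algebra_simps if_distrib cong: if_cong)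
qed

lemma T_Z_shift: "a \<in> T_Z \<Longrightarrow> (\<lambda>j. a (j + k)) \<in> T_Z"
  by (simp add: T_Z_iff interval_hat_shift)

lemma T_Z_reflect: "a \<in> T_Z \<Longrightarrow> (\<lambda>j. a (k - j)) \<in> T_Z"
  by (simp add: T_Z_iff interval_hat_reflect)

lemma T_Z_diff_scale:
  assumes "a \<in> T_Z" "g \<in> T_Z"
  shows "(\<lambda>j. a j - c * g j) \<in> T_Z"
proof -
  have "interval_hat n (\<lambda>j. a j - c * g j) i
      = (\<lambda>j. interval_hat n a i j - of_int c * interval_hat n g i j)" for n i
    by (auto simp: interval_hat_def)
  then show ?thesis using assms by (simp add: T_Z_iff N_sub_diff N_sub_scale)
qed

lemma T_Z_dtilde_dvd_right:
  assumes "a \<in> T_Z" "\<And>j. j < n \<Longrightarrow> a (i + int j) = 0"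
  shows "int (dtilde n) dvd a (i + int n)"
proof -
  have "interval_hat (Suc n) a i = (\<lambda>j. if j = n then of_int (a (i + int n)) else 0)"
    using assms(2) by (auto simp: interval_hat_def fun_eq_iff less_Suc_eq)
  then have "(of_nat (dtilde n) :: zhat) dvd of_int (a (i + int n))"
    using assms(1) by (metis T_Z_iff single_in_N_sub_iff)
  then show ?thesis by (simp add: of_nat_dvd_of_int_zhat dtilde_pos)
qed

lemma T_Z_dtilde_dvd_left:
  assumes "a \<in> T_Z" "\<And>j. j < n \<Longrightarrow> a (i - int j) = 0"
  shows "int (dtilde n) dvd a (i - int n)"
  using T_Z_dtilde_dvd_right[OF T_Z_reflect[OF assms(1), of i], of n 0] assms(2) by simp

section \<open>Extension of intervals and existence of leading sequences\<close>

text \<open>\<open>N_sub_extend\<close> yields a profinite new entry. It may be changed by any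
  multiple of \<open>dtilde n\<close>, and modulo \<open>dtilde n\<close> it is an integer.\<close>

lemma interval_hat_extend_right:
  assumes "interval_hat n a i \<in> N_sub n"
  shows "\<exists>x. interval_hat (Suc n) (a(i + int n := x)) i \<in> N_sub (Suc n)"
proof -
  obtain w where w: "w \<in> N_sub (Suc n)" "\<And>j. j < n \<Longrightarrow> w j = interval_hat n a i j"
    using N_sub_extend[OF assms] by blast
  define x where "x = Rep_zhat (w n) (dtilde n)"
  have "(\<lambda>j. if j = n then w n - of_int x else 0) \<in> N_sub (Suc n)"
    unfolding single_in_N_sub_iff x_def by (rule of_nat_dvd_diff_Rep_zhat[OF dtilde_pos])
  from N_sub_diff[OF w(1) this]
  have "(\<lambda>j. w j - (if j = n then w n - of_int x else 0)) \<in> N_sub (Suc n)" .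
  moreover have "(\<lambda>j. w j - (if j = n then w n - of_int x else 0))
      = interval_hat (Suc n) (a(i + int n := x)) i"
    using w(2) N_sub_support[OF w(1)] by (auto simp: interval_hat_def fun_eq_iff less_Suc_eq)
  ultimately show ?thesis by metis
qed

lemma interval_hat_extend_left:
  assumes "interval_hat n a i \<in> N_sub n"
  shows "\<exists>x. interval_hat (Suc n) (a(i - 1 := x)) (i - 1) \<in> N_sub (Suc n)"
proof -
  \<comment> \<open>Reflection at 0 moves the interval to start at \<open>k\<close>; the next place
    on its right, \<open>k + int n\<close>, is the reflection of \<open>i - 1\<close>.\<close>
  define k where "k = 1 - i - int n"
  have "interval_hat n (\<lambda>j. a (0 - j)) k \<in> N_sub n"
    using assms by (intro interval_hat_reflect) (simp add: k_def)
  from interval_hat_extend_right[OF this]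
  obtain x where x: "interval_hat (Suc n) ((\<lambda>j. a (0 - j))(k + int n := x)) k \<in> N_sub (Suc n)"
    by blast
  have "interval_hat (Suc n) (\<lambda>j. ((\<lambda>j. a (0 - j))(k + int n := x)) (0 - j)) (i - 1)
      \<in> N_sub (Suc n)"
    using interval_hat_reflect[of "Suc n" "(\<lambda>j. a (0 - j))(k + int n := x)" 0 "i - 1"] x
    by (simp add: k_def algebra_simps del: fun_upd_apply)
  moreover have "(\<lambda>j. ((\<lambda>j. a (0 - j))(k + int n := x)) (0 - j)) = a(i - 1 := x)"
    by (auto simp: k_def fun_eq_iff)
  ultimately show ?thesis by auto
qed

lemma interval_hat_extend:
  assumes "interval_hat n a i \<in> N_sub n"
  shows "\<exists>a'. interval_hat (Suc (Suc n)) a' (i - 1) \<in> N_sub (Suc (Suc n)) \<and>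
    (\<forall>j. i \<le> j \<and> j < i + int n \<longrightarrow> a' j = a j)"
proof -
  obtain x where "interval_hat (Suc n) (a(i + int n := x)) i \<in> N_sub (Suc n)"
    using interval_hat_extend_right[OF assms] by blast
  from interval_hat_extend_left[OF this] show ?thesis
    by (elim exE) (rule exI, rule conjI, assumption, simp)
qed

lemma is_leading_exists: "\<exists>g. is_leading n g"
proof -
  \<comment> \<open>Stage \<open>k\<close> has a valid interval on the window from \<open>-k\<close>
    to \<open>n + k\<close>, starting with \<open>(0, ..., 0, dtilde n)\<close> for
    \<open>k = 0\<close>; \<open>Q\<close> says that the next stage keeps the entries in this
    window.\<close>
  define P where "P k a \<longleftrightarrow> interval_hat (Suc n + 2 * k) a (- int k) \<in> N_sub (Suc n + 2 * k) \<and>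
      (\<forall>j<n. a (int j) = 0) \<and> a (int n) = int (dtilde n)" for k a
  define Q where "Q k a a' \<longleftrightarrow> (\<forall>j. - int k \<le> j \<and> j \<le> int (n + k) \<longrightarrow> a' j = a j)"
    for k and a a' :: "int \<Rightarrow> int"
  have "\<exists>a. P 0 a"
  proof
    let ?a = "\<lambda>j. if j = int n then int (dtilde n) else 0"
    have "interval_hat (Suc n) ?a 0 = (\<lambda>j. if j = n then of_nat (dtilde n) else 0)"
      by (auto simp: interval_hat_def)
    then show "P 0 ?a" by (simp add: P_def single_in_N_sub_iff)
  qed
  moreover have "\<exists>a'. P (Suc k) a' \<and> Q k a a'" if "P k a" for k a
  proof -
    from that have "interval_hat (Suc n + 2 * k) a (- int k) \<in> N_sub (Suc n + 2 * k)"
      by (simp add: P_def)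
    from interval_hat_extend[OF this] obtain a' where a':
      "interval_hat (Suc (Suc (Suc n + 2 * k))) a' (- int k - 1) \<in> N_sub (Suc (Suc (Suc n + 2 * k)))"
      "\<forall>j. - int k \<le> j \<and> j < - int k + int (Suc n + 2 * k) \<longrightarrow> a' j = a j"
      by blast
    moreover have "- int (Suc k) = - int k - 1" "Suc n + 2 * Suc k = Suc (Suc (Suc n + 2 * k))"
      by simp_all
    ultimately have "interval_hat (Suc n + 2 * Suc k) a' (- int (Suc k)) \<in> N_sub (Suc n + 2 * Suc k)"
      by metis
    then show ?thesis
      using that a'(2) unfolding P_def Q_def by (intro exI[of _ a']) auto
  qed
  ultimately obtain f where f: "\<And>k. P k (f k)" "\<And>k. Q k (f k) (f (Suc k))"
    using dependent_nat_choice[of P Q] by blast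
  have stable: "f l j = f k j" if "k \<le> l" "\<bar>j\<bar> \<le> int k" for k l j
    using that
  proof (induction l rule: dec_induct)
    case (step l)
    then have "- int l \<le> j \<and> j \<le> int (n + l)" by auto
    then have "f (Suc l) j = f l j" using f(2)[of l] unfolding Q_def by blast
    then show ?case using step by simp
  qed simp
  \<comment> \<open>The window of stage \<open>nat \<bar>j\<bar>\<close> contains \<open>j\<close>,
    so the entry at \<open>j\<close> is final from there on.\<close>
  define g where "g j = f (nat \<bar>j\<bar>) j" for j
  have g: "g j = f k j" if "\<bar>j\<bar> \<le> int k" for j k
    unfolding g_def using that by (intro stable[symmetric]) auto
  have "g \<in> T_Z"
    unfolding T_Z_iff
  proof (intro allI)
    fix m i
    define K where "K = nat \<bar>i\<bar> + m"
    have "interval_hat m g i = interval_hat m (f K) i"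
      using g[of _ K] by (auto simp: interval_hat_def fun_eq_iff K_def)
    also have "\<dots> \<in> N_sub m"
    proof (rule interval_hat_subinterval)
      show "interval_hat (Suc n + 2 * K) (f K) (- int K) \<in> N_sub (Suc n + 2 * K)"
        using f(1)[of K] unfolding P_def by blast
      have "int K = \<bar>i\<bar> + int m" by (simp add: K_def)
      then show "- int K \<le> i" "i + int m \<le> - int K + int (Suc n + 2 * K)" by linarith+
    qed
    finally show "interval_hat m g i \<in> N_sub m" .
  qed
  moreover have "g (int j) = f j (int j)" for j by (simp add: g_def)
  then have "\<forall>j<n. g (int j) = 0" "g (int n) = int (dtilde n)"
    using f(1) by (auto simp: P_def)
  ultimately show ?thesis by (auto simp: is_leading_def)
qed


section \<open>The expansion\<close>

text \<open>The summands are listed as a single sequence: the \<open>k\<close>-th one vanishes at the first \<open>k\<close> of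
  the positions 0, 1, -1, 2, -2, ... .\<close>

definition pos :: "nat \<Rightarrow> int" where
  "pos k = (if even k then - int (k div 2) else int (k div 2) + 1)"

definition term_seq :: "(nat \<Rightarrow> int \<Rightarrow> int) \<Rightarrow> nat \<Rightarrow> int \<Rightarrow> int" where
  "term_seq f k = (\<lambda>j. if even k then f k (int (k div 2) - j) else f k (j + int (k div 2)))"

lemma pos_surj: "\<exists>k. j = pos k"
proof (cases "j \<le> 0")
  case True
  then show ?thesis by (intro exI[of _ "2 * nat (- j)"]) (simp add: pos_def)
next
  case False
  then show ?thesis by (intro exI[of _ "Suc (2 * nat (j - 1))"]) (simp add: pos_def)
qed

lemma funpow_shift: "(shift ^^ i) a = (\<lambda>j. a (j + int i))"
  by (induction i) (auto simp: shift_def algebra_simps)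

lemma funpow_inv_shift: "(inv shift ^^ i) a = (\<lambda>j. a (j - int i))"
  by (induction i) (auto simp: inv_shift algebra_simps)

text \<open>The first \<open>k\<close> positions form an interval adjacent to \<open>pos k\<close>.
  The shift, or reflection and shift, in the \<open>k\<close>-th term carries the block
  \<open>0, ..., k - 1\<close>, where \<open>f k\<close> vanishes, onto this interval and
  \<open>k\<close> to \<open>pos k\<close>.\<close>

lemma term_seq_pos:
  assumes "\<And>n. is_leading n (f n)"
  shows "m < k \<Longrightarrow> term_seq f k (pos m) = 0" "term_seq f k (pos k) = int (dtilde k)"
    "term_seq f k \<in> T_Z"
proof -
  have f: "f k \<in> T_Z" "\<And>j. j < k \<Longrightarrow> f k (int j) = 0" "f k (int k) = int (dtilde k)"
    using assms[of k] by (auto simp: is_leading_def)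
  show "term_seq f k \<in> T_Z"
    using f(1) T_Z_shift T_Z_reflect by (cases "even k") (simp_all add: term_seq_def)
  define x where "x m = (if even k then int (k div 2) - pos m else pos m + int (k div 2))" for m
  have x: "term_seq f k (pos m) = f k (x m)" for m
    by (simp add: term_seq_def x_def)
  have "x k = int k"
    by (cases "even k") (auto simp: x_def pos_def elim!: evenE oddE)
  then show "term_seq f k (pos k) = int (dtilde k)" by (simp add: x f(3))
  assume m: "m < k"
  have "0 \<le> x m \<and> x m < int k"
    using m by (cases "even k"; cases "even m") (auto simp: x_def pos_def elim!: evenE oddE)
  then show "term_seq f k (pos m) = 0"
    using f(2)[of "nat (x m)"] by (simp add: x nat_less_iff)
qed

text \<open>The first \<open>k\<close> positions form an interval of length \<open>k\<close>, and
  \<open>pos k\<close> is its neighbour on the left for even \<open>k\<close> and on the right for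
  odd \<open>k\<close>.\<close>

lemma T_Z_dtilde_dvd_pos:
  assumes a: "a \<in> T_Z" and zero: "\<And>m. m < k \<Longrightarrow> a (pos m) = 0"
  shows "int (dtilde k) dvd a (pos k)"
proof -
  define l where "l = k div 2"
  show ?thesis
  proof (cases "even k")
    case True
    then have k: "k = 2 * l" by (simp add: l_def)
    have "a (int l - int j) = 0" if "j < k" for j
    proof -
      have "\<exists>m<k. int l - int j = pos m"
        using that k
        \<comment> \<open>A positive position \<open>p\<close> has index
          \<open>2 * (p - 1) + 1\<close>, a position \<open>- q\<close> with \<open>q\<close> at
          least 0 has index \<open>2 * q\<close>.\<close>
        by (intro exI[of _ "if j < l then 2 * (l - j - 1) + 1 else 2 * (j - l)"])
          (auto simp: pos_def)
      then show ?thesis using zero by auto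
    qed
    then show ?thesis using T_Z_dtilde_dvd_left[OF a, of k "int l"] by (simp add: pos_def k)
  next
    case False
    then have k: "k = 2 * l + 1" by (simp add: l_def)
    have "a (- int l + int j) = 0" if "j < k" for j
    proof -
      have "\<exists>m<k. - int l + int j = pos m"
        using that k
        by (intro exI[of _ "if j \<le> l then 2 * (l - j) else 2 * (j - l - 1) + 1"])
          (auto simp: pos_def)
      then show ?thesis using zero by auto
    qed
    then show ?thesis using T_Z_dtilde_dvd_right[OF a, of k "- int l"] by (simp add: pos_def k)
  qed
qed

lemma sum_upto_double:
  fixes F :: "nat \<Rightarrow> 'a::comm_monoid_add"
  shows "(\<Sum>i<n. F (2 * i) + F (2 * i + 1)) = (\<Sum>m<2 * n. F m)"
  by (induction n) (auto simp: ac_simps)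

text \<open>At \<open>pos k\<close> all terms after the \<open>k\<close>-th vanish, so the infinite
  sum becomes a triangular linear system with diagonal entries \<open>dtilde k\<close>.\<close>

lemma sums_termwise_iff:
  assumes "\<And>n. is_leading n (f n)"
  shows "sums_termwise
      (\<lambda>i j. b (2 * i) * (inv shift ^^ i) (reflect (f (2 * i))) j
           + b (2 * i + 1) * (shift ^^ i) (f (2 * i + 1)) j) a
    \<longleftrightarrow> (\<forall>k. a (pos k) = (\<Sum>m\<le>k. b m * term_seq f m (pos k)))"
proof -
  define G where "G m j = b m * term_seq f m j" for m j
  define F where "F i j = G (2 * i) j + G (2 * i + 1) j" for i j
  have F: "(\<lambda>i j. b (2 * i) * (inv shift ^^ i) (reflect (f (2 * i))) j
      + b (2 * i + 1) * (shift ^^ i) (f (2 * i + 1)) j) = F"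
    by (auto simp: F_def G_def term_seq_def funpow_shift funpow_inv_shift reflect_def fun_eq_iff)
  have zero: "G m (pos k) = 0" if "k < m" for m k
    using term_seq_pos(1)[OF assms that] by (simp add: G_def)
  have sub: "{i. F i (pos k) \<noteq> 0} \<subseteq> {..<Suc k}" for k
  proof
    fix i assume "i \<in> {i. F i (pos k) \<noteq> 0}"
    then have "\<not> (k < 2 * i)" using zero[of k "2 * i"] zero[of k "2 * i + 1"] by (auto simp: F_def)
    then show "i \<in> {..<Suc k}" by simp
  qed
  have "(\<Sum>i | F i (pos k) \<noteq> 0. F i (pos k)) = (\<Sum>m\<le>k. G m (pos k))" for k
  proof -
    have "(\<Sum>i | F i (pos k) \<noteq> 0. F i (pos k)) = (\<Sum>i<Suc k. F i (pos k))"
      using sub by (intro sum.mono_neutral_left) auto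
    also have "\<dots> = (\<Sum>m<2 * Suc k. G m (pos k))"
      unfolding F_def by (rule sum_upto_double)
    also have "\<dots> = (\<Sum>m\<le>k. G m (pos k))"
      by (rule sum.mono_neutral_right) (auto intro: zero)
    finally show ?thesis .
  qed
  moreover have "finite {i. F i (pos k) \<noteq> 0}" for k
    using sub finite_subset by blast
  ultimately have "sums_termwise F a \<longleftrightarrow> (\<forall>k. a (pos k) = (\<Sum>m\<le>k. G m (pos k)))"
    unfolding sums_termwise_def by (metis pos_surj)
  then show ?thesis by (simp only: F) (simp add: G_def)
qed

lemma expansion_exists:
  assumes lead: "\<And>n. is_leading n (f n)" and a: "a \<in> T_Z"
  shows "\<exists>b. \<forall>k. a (pos k) = (\<Sum>m\<le>k. b m * term_seq f m (pos k))"
proof -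
  \<comment> \<open>\<open>res k\<close> is the remainder of \<open>a\<close> after subtracting the
    first \<open>k\<close> terms. It stays in \<open>T_Z\<close> and vanishes at the first
    \<open>k\<close> positions, so the next division by \<open>dtilde k\<close> is exact.\<close>
  define res where "res = rec_nat a (\<lambda>k r j. r j - (r (pos k) div int (dtilde k)) * term_seq f k j)"
  define b where "b k = res k (pos k) div int (dtilde k)" for k
  have res_0: "res 0 = a" and res_Suc: "res (Suc k) = (\<lambda>j. res k j - b k * term_seq f k j)" for k
    by (simp_all add: res_def b_def)
  have inv: "res k \<in> T_Z \<and> (\<forall>m<k. res k (pos m) = 0)" for k
  proof (induction k)
    case (Suc k)
    then have "int (dtilde k) dvd res k (pos k)" by (intro T_Z_dtilde_dvd_pos) auto
    then have "res (Suc k) (pos k) = 0"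
      by (simp add: res_Suc b_def term_seq_pos(2)[OF lead])
    then show ?case
      using Suc term_seq_pos(1,3)[OF lead]
      by (auto simp: res_Suc less_Suc_eq intro: T_Z_diff_scale)
  qed (simp add: res_0 a)
  have sum: "a j = res k j + (\<Sum>m<k. b m * term_seq f m j)" for k j
    by (induction k) (simp_all add: res_0 res_Suc)
  have "a (pos k) = (\<Sum>m\<le>k. b m * term_seq f m (pos k))" for k
    using sum[of "pos k" "Suc k"] inv[of "Suc k"] by (simp add: lessThan_Suc_atMost)
  then show ?thesis by blast
qed

text \<open>The diagonal entries of the triangular system are nonzero.\<close>

lemma expansion_unique:
  assumes lead: "\<And>n. is_leading n (f n)"
    and b: "\<And>k. a (pos k) = (\<Sum>m\<le>k. b m * term_seq f m (pos k))"
    and c: "\<And>k. a (pos k) = (\<Sum>m\<le>k. c m * term_seq f m (pos k))"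
  shows "b = c"
proof
  fix k
  show "b k = c k"
  proof (induction k rule: less_induct)
    case (less k)
    have "(\<Sum>m<k. b m * term_seq f m (pos k)) = (\<Sum>m<k. c m * term_seq f m (pos k))"
      using less by simp
    moreover have "a (pos k) = (\<Sum>m<k. b m * term_seq f m (pos k)) + b k * int (dtilde k)"
      using b[of k] by (simp add: term_seq_pos(2)[OF lead] flip: lessThan_Suc_atMost)
    moreover have "a (pos k) = (\<Sum>m<k. c m * term_seq f m (pos k)) + c k * int (dtilde k)"
      using c[of k] by (simp add: term_seq_pos(2)[OF lead] flip: lessThan_Suc_atMost)
    ultimately have "b k * int (dtilde k) = c k * int (dtilde k)" by linarith
    then show ?case using dtilde_pos[of k] by auto
  qed
qed


section \<open>Stable operations\<close>

unbundle fps_syntax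

lemma Phi_nth: "Phi G $ k = int k * G $ k - int (Suc k) * G $ Suc k"
  by (cases k) (simp_all add: Phi_def left_diff_distrib fps_X_mult_nth algebra_simps)

lemma Phi_diff: "Phi (F - G) = Phi F - Phi G"
  by (simp add: Phi_def algebra_simps)

lemma Phi_const_mult: "Phi (fps_const c * G) = fps_const c * Phi G"
  by (simp add: Phi_def algebra_simps)

lemma Phi_power: "Phi ((1 - fps_X) ^ m) = fps_const (int m) * (1 - fps_X) ^ m"
proof (cases m)
  case (Suc n)
  have X: "fps_deriv (1 - fps_X) = (- 1 :: int fps)" by simp
  have *: "(x - 1) * (c * - 1 * p) = c * ((1 - x) * p)" for x c p :: "int fps"
    by (simp add: algebra_simps)
  have "Phi ((1 - fps_X) ^ Suc n)
      = (fps_X - 1) * (fps_const (int (Suc n)) * - 1 * (1 - fps_X) ^ n)"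
    unfolding Phi_def fps_deriv_power X by simp
  also have "\<dots> = fps_const (int (Suc n)) * ((1 - fps_X) * (1 - fps_X) ^ n)"
    by (rule *)
  finally show ?thesis by (simp add: Suc)
qed (simp add: Phi_def)

text \<open>An explicit candidate for \<open>b_map\<close>: \<open>(1 - x) ^ m\<close> is an
  eigenvector of \<open>Phi\<close> with eigenvalue \<open>m\<close> and constant coefficient
  1.\<close>

definition b_fun :: "int fps \<Rightarrow> nat \<Rightarrow> int" where
  "b_fun G = (\<lambda>j. (Phi ^^ j) G $ 0)"

lemma funpow_Phi_diff: "(Phi ^^ j) (F - G) = (Phi ^^ j) F - (Phi ^^ j) G"
  by (induction j) (simp_all add: Phi_diff)

lemma b_fun_diff: "b_fun (F - G) = b_fun F - b_fun G"
  by (simp add: b_fun_def funpow_Phi_diff fun_eq_iff)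

lemma b_fun_0: "b_fun 0 = 0"
  using b_fun_diff[of 0 0] by simp

lemma b_fun_add: "b_fun (F + G) = b_fun F + b_fun G"
  using b_fun_diff[of F "- G"] b_fun_diff[of 0 G] by (simp add: b_fun_0)

lemma b_fun_funpow_Phi: "b_fun ((Phi ^^ k) G) j = b_fun G (j + k)"
  by (simp add: b_fun_def funpow_add)

lemma b_fun_Phi: "b_fun (Phi G) j = b_fun G (Suc j)"
  using b_fun_funpow_Phi[of 1] by simp

lemma b_fun_power: "b_fun ((1 - fps_X) ^ m) = (\<lambda>j. int m ^ j)"
proof -
  have "(Phi ^^ j) ((1 - fps_X) ^ m) = fps_const (int m ^ j) * (1 - fps_X) ^ m" for j
    by (induction j) (simp_all add: Phi_const_mult Phi_power mult.assoc[symmetric] mult.commute)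
  then show ?thesis by (simp add: b_fun_def fps_power_zeroth)
qed

text \<open>By \<open>Phi_nth\<close>, the \<open>k\<close>-th coefficients of a series and of its
  image under \<open>Phi\<close> determine \<open>Suc k\<close> times the next coefficient. So both
  conditions amount to the vanishing of the whole triangle \<open>j + k < n\<close>. Injectivity and
  continuity of \<open>b_fun\<close> follow.\<close>

lemma b_fun_zero_iff: "(\<forall>j<n. b_fun G j = 0) \<longleftrightarrow> (\<forall>k<n. G $ k = 0)"
proof
  assume b: "\<forall>j<n. b_fun G j = 0"
  have "\<forall>j. j + k < n \<longrightarrow> (Phi ^^ j) G $ k = 0" for k
  proof (induction k)
    case (Suc k)
    show ?case
    proof (intro allI impI)
      fix j assume "j + Suc k < n"
      then have "(Phi ^^ j) G $ k = 0" "(Phi ^^ Suc j) G $ k = 0"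
        using Suc.IH[rule_format, of j] Suc.IH[rule_format, of "Suc j"] by simp_all
      then show "(Phi ^^ j) G $ Suc k = 0" by (simp add: Phi_nth)
    qed
  qed (use b in \<open>simp add: b_fun_def\<close>)
  from this[rule_format, of 0] show "\<forall>k<n. G $ k = 0" by simp
next
  assume G: "\<forall>k<n. G $ k = 0"
  have "\<forall>k. j + k < n \<longrightarrow> (Phi ^^ j) G $ k = 0" for j
    by (induction j) (use G in \<open>simp_all add: Phi_nth\<close>)
  then show "\<forall>j<n. b_fun G j = 0" by (simp add: b_fun_def)
qed

lemma b_fun_eq_iff: "(\<forall>j<n. b_fun F j = b_fun G j) \<longleftrightarrow> (\<forall>k<n. F $ k = G $ k)"
  using b_fun_zero_iff[of n "F - G"] by (simp add: b_fun_diff)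

lemma inj_b_fun: "inj b_fun"
proof (rule injI)
  fix F G assume "b_fun F = b_fun G"
  then have "\<forall>k<n. F $ k = G $ k" for n by (simp flip: b_fun_eq_iff)
  then show "F = G" by (metis fps_ext lessI)
qed

text \<open>Entry \<open>j\<close> depends only on the coefficients up to \<open>j\<close>, hence is
  locally constant.\<close>

lemma continuous_b_fun: "continuous_on UNIV b_fun"
proof (rule continuous_on_coordinatewise_then_product)
  fix j
  show "continuous_on UNIV (\<lambda>G. b_fun G j)"
    unfolding continuous_on_def
  proof
    fix F :: "int fps"
    have near: "b_fun G j = b_fun F j" if "dist G F < inverse (2 ^ j)" for G
    proof -
      have "\<forall>k<Suc j. G $ k = F $ k"
        using dist_less_imp_nth_equal[OF that] by simp
      then show ?thesis by (simp flip: b_fun_eq_iff)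
    qed
    have "eventually (\<lambda>G. b_fun G j = b_fun F j) (at F)"
      unfolding eventually_at by (rule exI[of _ "inverse (2 ^ j)"]) (auto intro: near)
    then show "((\<lambda>G. b_fun G j) \<longlongrightarrow> b_fun F j) (at F within UNIV)"
      by (simp add: nhds_discrete filterlim_principal)
  qed
qed

section \<open>Uniqueness of \<open>b_map\<close>\<close>

text \<open>Induction by \<open>x * F = F - (1 - x) * F\<close>. The bound \<open>m0\<close> is 0 in
  the uniqueness of \<open>b_map\<close> and 1 for \<open>M_sub\<close>, whose bases are
  positive.\<close>

lemma fps_X_power_in_subgroup:
  fixes S :: "'a::comm_ring_1 fps set"
  assumes diff: "\<And>F G. F \<in> S \<Longrightarrow> G \<in> S \<Longrightarrow> F - G \<in> S"
    and power: "\<And>m. m \<ge> m0 \<Longrightarrow> (1 - fps_X) ^ m \<in> S"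
  shows "m \<ge> m0 \<Longrightarrow> fps_X ^ k * (1 - fps_X) ^ m \<in> S"
proof (induction k arbitrary: m)
  case (Suc k)
  have "fps_X ^ k * (1 - fps_X) ^ m - fps_X ^ k * (1 - fps_X) ^ Suc m \<in> S"
    using Suc.IH[of m] Suc.IH[of "Suc m"] Suc.prems by (intro diff) simp_all
  then show ?case by (simp add: algebra_simps)
qed (simp add: power)

lemma fps_truncation_in_subgroup:
  fixes S :: "int fps set"
  assumes diff: "\<And>F G. F \<in> S \<Longrightarrow> G \<in> S \<Longrightarrow> F - G \<in> S"
    and X: "\<And>k. fps_X ^ k \<in> S"
  shows "(\<Sum>i\<in>A. fps_const (F $ i) * fps_X ^ i) \<in> S"
proof -
  have zero: "0 \<in> S" using diff[OF X[of 0] X[of 0]] by simp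
  have add: "F + G \<in> S" if "F \<in> S" "G \<in> S" for F G
    using diff[OF that(1) diff[OF zero that(2)]] by simp
  have nat: "fps_const (int c) * fps_X ^ k \<in> S" for c k
  proof (induction c)
    case (Suc c)
    have "fps_const (int (Suc c)) * fps_X ^ k = fps_X ^ k + fps_const (int c) * fps_X ^ k"
      by (simp add: distrib_right flip: fps_const_add)
    then show ?case using add[OF X Suc] by simp
  qed (simp add: zero)
  have "fps_const c * fps_X ^ k \<in> S" for c k
  proof (cases c rule: int_diff_cases)
    case (diff p q)
    have "fps_const c * fps_X ^ k = fps_const (int p) * fps_X ^ k - fps_const (int q) * fps_X ^ k"
      by (simp add: diff left_diff_distrib flip: fps_const_sub)
    then show ?thesis using assms(1) nat by simp
  qed
  then show ?thesis
    by (induction A rule: infinite_finite_induct) (auto simp: zero add)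
qed

text \<open>Additivity fixes the map on the span of the powers of \<open>1 - x\<close>, which
  contains all polynomials; these are dense, so continuity does the rest.\<close>

lemma b_map_eq: "b_map = b_fun"
  unfolding b_map_def
proof (rule the_equality)
  show "inj b_fun \<and> (\<forall>F G. b_fun (F + G) = b_fun F + b_fun G) \<and> continuous_on UNIV b_fun \<and>
      (\<forall>m::nat. b_fun ((1 - fps_X) ^ m) = (\<lambda>j. int m ^ j))"
    by (simp add: inj_b_fun b_fun_add continuous_b_fun b_fun_power)
next
  fix b :: "int fps \<Rightarrow> nat \<Rightarrow> int"
  assume b: "inj b \<and> (\<forall>F G. b (F + G) = b F + b G) \<and> continuous_on UNIV b \<and>
      (\<forall>m::nat. b ((1 - fps_X) ^ m) = (\<lambda>j. int m ^ j))"
  then have add: "b (F + G) = b F + b G" for F G by blast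
  have diff: "b (F - G) = b F - b G" for F G
    using add[of "F - G" G] by simp
  define S where "S = {F. b F = b_fun F}"
  have S_diff: "F - G \<in> S" if "F \<in> S" "G \<in> S" for F G
    using that by (simp add: S_def diff b_fun_diff)
  have S_power: "(1 - fps_X) ^ m \<in> S" for m
    using b by (simp add: S_def b_fun_power)
  have S_X: "fps_X ^ k \<in> S" for k
    using fps_X_power_in_subgroup[of S 0 0 k] S_diff S_power by simp
  show "b = b_fun"
  proof (intro ext)
    fix F :: "int fps" and j
    define T where "T n = (\<Sum>i=0..n. fps_const (F $ i) * fps_X ^ i)" for n
    have T: "T \<longlonglongrightarrow> F" unfolding T_def by (rule fps_notation)
    have lim: "(\<lambda>n. c (T n) j) \<longlonglongrightarrow> c F j" if "continuous_on UNIV c" for c :: "int fps \<Rightarrow> nat \<Rightarrow> int"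
      using continuous_on_tendsto_compose[OF continuous_on_product_then_coordinatewise[OF that] T]
      by simp
    have "(\<lambda>n. b (T n) j) \<longlonglongrightarrow> b F j" using b by (intro lim) blast
    moreover have "b (T n) = b_fun (T n)" for n
      using fps_truncation_in_subgroup[of S F "{0..n}"] S_diff S_X by (simp add: S_def T_def)
    ultimately show "b F j = b_fun F j"
      using LIMSEQ_unique[OF _ lim[OF continuous_b_fun]] by simp
  qed
qed

section \<open>The image of \<open>b_fun\<close>\<close>

lemma b_fun_in_M_sub: "(\<lambda>j. if j < n then b_fun G j else 0) \<in> M_sub n"
proof -
  define S where "S = {G. (\<lambda>j. if j < n then b_fun G j else 0) \<in> M_sub n}"
  have diff: "F - G \<in> S" if "F \<in> S" "G \<in> S" for F G
  proof -
    have "(\<lambda>j. if j < n then b_fun (F - G) j else 0)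
        = (\<lambda>j. if j < n then b_fun F j else 0) - (\<lambda>j. if j < n then b_fun G j else 0)"
      by (auto simp: b_fun_diff fun_eq_iff)
    then show ?thesis using M_sub_diff that by (simp add: S_def)
  qed
  have cong: "F \<in> S" if "G \<in> S" "\<forall>k<n. F $ k = G $ k" for F G
  proof -
    have "\<forall>j<n. b_fun F j = b_fun G j" using that(2) by (simp add: b_fun_eq_iff)
    then have "(\<lambda>j. if j < n then b_fun F j else 0) = (\<lambda>j. if j < n then b_fun G j else 0)"
      by auto
    then show ?thesis using that(1) by (simp add: S_def)
  qed
  have power: "(1 - fps_X) ^ m \<in> S" if "m \<ge> 1" for m
    using M_sub_power_tuple[of "int m" n] that
    by (simp add: S_def b_fun_power power_tuple_def cong: if_cong)
  have zero: "0 \<in> S" using diff[OF power power, of 1 1] by simp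
  \<comment> \<open>The series 1 corresponds to base 0, which is not among the generators. So the
    induction descends from \<open>x ^ n\<close>, which counts as 0 here, by
    \<open>x ^ k = x ^ k * (1 - x) + x ^ (k + 1)\<close>.\<close>
  have "fps_X ^ k \<in> S" for k
  proof (cases "k \<le> n")
    case True
    then show ?thesis
    proof (induction k rule: inc_induct)
      case base
      show ?case by (rule cong[OF zero]) simp
    next
      case (step k)
      have "fps_X ^ k * (1 - fps_X) ^ 1 \<in> S"
        by (rule fps_X_power_in_subgroup[of S 1]) (auto intro: diff power)
      then have "fps_X ^ k * (1 - fps_X) - (0 - fps_X ^ Suc k) \<in> S"
        using step.IH by (intro diff zero) auto
      then show ?case by (simp add: algebra_simps)
    qed
  qed (auto intro: cong[OF zero])
  then have "(\<Sum>i<n. fps_const (G $ i) * fps_X ^ i) \<in> S"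
    by (intro fps_truncation_in_subgroup diff)
  then have "G \<in> S"
    by (rule cong) (simp add: fps_sum_nth fps_X_power_nth if_distrib[of "(*) _"] cong: if_cong)
  then show ?thesis by (simp add: S_def)
qed

lemma b_fun_surj:
  assumes "\<And>n. (\<lambda>j. if j < n then c j else 0) \<in> M_sub n"
  shows "c \<in> range b_fun"
proof -
  have "\<exists>P. \<forall>j<n. b_fun P j = v j" if "v \<in> M_sub n" for n v
    using that unfolding M_sub_def
  proof (induction rule: group_closure.induct)
    case (base v)
    show ?case
    proof (cases "v = 0")
      case True
      then show ?thesis by (intro exI[of _ 0]) (simp add: b_fun_0)
    next
      case False
      with base obtain r :: int where "r > 0" "v = power_tuple n r" by blast
      then show ?thesis
        by (intro exI[of _ "(1 - fps_X) ^ nat r"]) (simp add: b_fun_power power_tuple_def)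
    qed
  next
    case (diff v w)
    then obtain P Q where "\<forall>j<n. b_fun P j = v j" "\<forall>j<n. b_fun Q j = w j" by blast
    then show ?case by (intro exI[of _ "P - Q"]) (simp add: b_fun_diff)
  qed
  from this[OF assms] have "\<forall>n. \<exists>P. \<forall>j<n. b_fun P j = c j" by simp
  then obtain P where P: "\<And>n j. j < n \<Longrightarrow> b_fun (P n) j = c j"
    by metis
  \<comment> \<open>The approximations \<open>P n\<close> agree in their common range of
    coefficients, and \<open>P (Suc k)\<close> is the first to determine the \<open>k\<close>-th
    one.\<close>
  define G where "G = Abs_fps (\<lambda>k. P (Suc k) $ k)"
  have "b_fun G j = c j" for j
  proof -
    have "G $ k = P (Suc j) $ k" if "k < Suc j" for k
    proof -
      have "\<forall>i<Suc k. b_fun (P (Suc k)) i = b_fun (P (Suc j)) i"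
        using P that by simp
      then show ?thesis unfolding b_fun_eq_iff by (simp add: G_def)
    qed
    then have "b_fun G j = b_fun (P (Suc j)) j"
      using b_fun_eq_iff[of "Suc j" G "P (Suc j)"] by blast
    then show ?thesis using P by simp
  qed
  then have "c = b_fun G" by auto
  then show ?thesis by blast
qed

section \<open>The isomorphism with stable operations\<close>

definition stable_op :: "(int \<Rightarrow> int) \<Rightarrow> nat \<Rightarrow> int fps" where
  "stable_op a n = inv b_fun (\<lambda>j. a (int j - int n))"

lemma b_fun_stable_op:
  assumes "a \<in> T_Z"
  shows "b_fun (stable_op a n) = (\<lambda>j. a (int j - int n))"
  unfolding stable_op_def
proof (intro f_inv_into_f b_fun_surj)
  fix N
  have "interval_at N a (- int n) \<in> M_sub N"
    using assms M_sub_zero[of 0]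
    by (cases "N = 0") (auto simp: T_Z_def interval_at_def zero_fun_def)
  moreover have "- int n + int j = int j - int n" for j by simp
  ultimately show "(\<lambda>j. if j < N then a (int j - int n) else 0) \<in> M_sub N"
    by (simp only: interval_at_def)
qed

lemma stable_op_eqI: "b_fun G = (\<lambda>j. a (int j - int n)) \<Longrightarrow> stable_op a n = G"
  unfolding stable_op_def by (metis inj_b_fun inv_f_f)

lemma stable_op_in_Op_st:
  assumes "a \<in> T_Z"
  shows "stable_op a \<in> Op_st"
  unfolding Op_st_def
proof (intro CollectI allI stable_op_eqI)
  fix n
  show "b_fun (Phi (stable_op a (Suc n))) = (\<lambda>j. a (int j - int n))"
    by (simp add: fun_eq_iff b_fun_Phi b_fun_stable_op[OF assms])
qed

lemma stable_op_surj:
  assumes "G \<in> Op_st"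
  shows "\<exists>a\<in>T_Z. stable_op a = G"
proof -
  have Op: "\<forall>m. G m = Phi (G (Suc m))"
    using assms unfolding Op_st_def by (rule CollectD)
  have Phi_G: "Phi (G (Suc m)) = G m" for m
    by (rule sym) (rule Op[THEN spec])
  \<comment> \<open>Nonnegative positions are read from \<open>G 0\<close>, and \<open>- n\<close>
    is entry 0 of \<open>G n\<close>; the other entries are consistent because \<open>Phi\<close>
    acts on \<open>b_fun\<close> as the shift.\<close>
  define a where "a i = b_fun (G (nat (- i))) (nat i)" for i
  have G: "b_fun (G (n + k)) (j + k) = b_fun (G n) j" for n k j
  proof (induction k)
    case (Suc k)
    then show ?case using b_fun_Phi[of "G (Suc (n + k))" "j + k"] by (simp add: Phi_G)
  qed simp
  have a: "b_fun (G n) j = a (int j - int n)" for n j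
  proof (cases "j \<le> n")
    case True
    then show ?thesis using G[of "n - j" j 0] by (simp add: a_def nat_diff_distrib')
  next
    case False
    then show ?thesis using G[of 0 n "j - n"] by (simp add: a_def nat_diff_distrib')
  qed
  have "a \<in> T_Z"
    unfolding T_Z_def
  proof (intro CollectI allI impI)
    fix n i
    \<comment> \<open>A series whose coordinates start at position \<open>i\<close> of
      \<open>a\<close>: an iterated desuspension of \<open>G 0\<close> if \<open>i\<close> is
      nonnegative, and \<open>G (nat (- i))\<close> otherwise.\<close>
    define H where "H = (Phi ^^ nat i) (G (nat (- i)))"
    have "b_fun H j = a (i + int j)" for j
      by (simp add: H_def b_fun_funpow_Phi a) (simp add: algebra_simps)
    then show "interval_at n a i \<in> M_sub n"
      using b_fun_in_M_sub[of n H] by (simp add: interval_at_def cong: if_cong)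
  qed
  moreover have "stable_op a = G"
    by (intro ext stable_op_eqI) (simp add: a)
  ultimately show ?thesis by blast
qed

lemma is_stable_iso_stable_op: "is_stable_iso stable_op"
  unfolding is_stable_iso_def b_map_eq
proof (intro conjI ballI allI)
  show "bij_betw stable_op T_Z Op_st"
    unfolding bij_betw_def
  proof
    show "inj_on stable_op T_Z"
    proof (intro inj_onI ext)
      fix a a' i assume *: "a \<in> T_Z" "a' \<in> T_Z" "stable_op a = stable_op a'"
      have "a (int j - int n) = a' (int j - int n)" for j n
        using b_fun_stable_op[OF *(1), of n] b_fun_stable_op[OF *(2), of n] *(3) by metis
      from this[of "nat i" "nat (- i)"] show "a i = a' i" by (cases "i \<ge> 0") auto
    qed
    show "stable_op ` T_Z = Op_st"
      using stable_op_in_Op_st stable_op_surj by blast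
  qed
next
  fix a a' assume "a \<in> T_Z" "a' \<in> T_Z"
  then show "stable_op (a + a') = stable_op a + stable_op a'"
    by (intro ext stable_op_eqI) (simp add: b_fun_add b_fun_stable_op fun_eq_iff)
next
  fix a n assume "a \<in> T_Z"
  then show "b_fun (stable_op a n) = (\<lambda>j. a (int j - int n))"
    by (rule b_fun_stable_op)
qed


theorem theorem6p33:
  shows "(\<exists>\<phi>. is_stable_iso \<phi>) \<and>
    (\<forall>n. \<exists>g. is_leading n g) \<and>
    (\<forall>f :: nat \<Rightarrow> int \<Rightarrow> int. (\<forall>n. is_leading n (f n)) \<longrightarrow>
      (\<forall>a\<in>T_Z. \<exists>!b :: nat \<Rightarrow> int.
        sums_termwise
          (\<lambda>i j. b (2 * i) * (inv shift ^^ i) (reflect (f (2 * i))) j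
               + b (2 * i + 1) * (shift ^^ i) (f (2 * i + 1)) j)
          a))"
proof (intro conjI allI impI ballI)
  show "\<exists>\<phi>. is_stable_iso \<phi>"
    using is_stable_iso_stable_op by blast
  show "\<exists>g. is_leading n g" for n
    by (rule is_leading_exists)
next
  fix f :: "nat \<Rightarrow> int \<Rightarrow> int" and a
  assume "\<forall>n. is_leading n (f n)" and a: "a \<in> T_Z"
  then have lead: "\<And>n. is_leading n (f n)" by blast
  have "\<exists>!b. \<forall>k. a (pos k) = (\<Sum>m\<le>k. b m * term_seq f m (pos k))"
  proof (rule ex_ex1I)
    show "\<exists>b. \<forall>k. a (pos k) = (\<Sum>m\<le>k. b m * term_seq f m (pos k))"
      using lead a by (rule expansion_exists)
    show "b = c"
      if "\<forall>k. a (pos k) = (\<Sum>m\<le>k. b m * term_seq f m (pos k))"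
        and "\<forall>k. a (pos k) = (\<Sum>m\<le>k. c m * term_seq f m (pos k))" for b c
      using that by (intro expansion_unique[of f a b c] lead) blast+
  qed
  then show "\<exists>!b. sums_termwise
      (\<lambda>i j. b (2 * i) * (inv shift ^^ i) (reflect (f (2 * i))) j
           + b (2 * i + 1) * (shift ^^ i) (f (2 * i + 1)) j)
      a"
    by (simp only: sums_termwise_iff[OF lead])
qed

end
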